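(* Let $f\neq 0$ and let the constant $C_0>0$ in the dynamic marking rule $\sqrt{1-\theta_n^2}=C_0\,\|r_n\|_{\phi^*}/\|r_0\|_{\phi^*}$ satisfy $$C_0\le \frac14\sqrt{\frac{\alpha_*}{\alpha^*}}\,\frac{\beta_*}{\beta^*},\qquad\text{and set}\qquad C_1:=\frac{\sqrt{\alpha^*}}{2\beta_*\|f\|_{\phi^*}} .$$ Then the residuals $r_n$ produced by the algorithm DYN-GAL satisfy $$\frac{\|r_{n+1}\|_{\phi^*}}{2\|r_0\|_{\phi^*}}\le\left(\frac{\|r_n\|_{\phi^*}}{2\|r_0\|_{\phi^*}}\right)^2\qquad\forall n\ge 0,$$ and the algorithm terminates in finitely many steps for any tolerance $\varepsilon>0$. In addition, two consecutive solutions of DYN-GAL satisfy, in the energy norm $|||\cdot|||$, $$|||u-u_{n+1}|||\le C_1\,|||u-u_n|||^2\qquad\forall n\ge0 .$$ (Here $n$ ranges over all indices for which the iterate $u_{n+1}$ is generated by the algorithm.)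
   Context: Problem. Let $d\ge1$, $\Omega\subset\mathbb R^d$ a rectangular domain, $V=H^1_0(\Omega)$ or $V=H^1_p(\Omega)$ (periodic functions), with dual $V^*$. Consider $Lu=-\nabla\cdot(\nu\nabla u)+\sigma u=f$ with $f\in V^*$ and sufficiently smooth real coefficients $0<\nu_*\le\nu\le\nu^*<\infty$, $0<\sigma_*\le\sigma\le\sigma^*<\infty$. Put $\alpha_*=\min(\nu_*,\sigma_* )$, $\alpha^*=\max(\nu^*,\sigma^* )$. Weak form: $u\in V$, $a(u,v)=\langle f,v\rangle$ for all $v\in V$, with $a(u,v)=\int_\Omega\nu\nabla u\cdot\nabla\bar v+\int_\Omega\sigma u\bar v$. The energy norm $|||v|||=\sqrt{a(v,v)}$ satisfies $\sqrt{\alpha_*}\|v\|_V\le|||v|||\le\sqrt{\alpha^*}\|v\|_V$. Basis. $\{\phi_k\}_{k\in\mathcal K}$, $\mathcal K\subset\mathbb Z^d$ infinite, is a Riesz basis of $V$: there are weights $d_k>0$ and constants $0<\beta_*\le\beta^*$ such that for $v=\sum_k\hat v_k\phi_k$, with $\|v\|_\phi^2:=\sum_k|\hat v_k|^2d_k$, one has $\beta_*\|v\|_V\le\|v\|_\phi\le\beta^*\|v\|_V$. With the dual basis $\{\phi_k^*\}$, $g\in V^*$ is written $g=\sum_k\hat g_k\phi_k^*$, $\hat g_k=\langle g,\phi_k\rangle$, and $\|g\|_{\phi^*}^2:=\sum_k|\hat g_k|^2d_k^{-1}$; hence $\frac1{\beta^*}\|g\|_{V^*}\le\|g\|_{\phi^*}\le\frac1{\beta_*}\|g\|_{V^*}$.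 For $\Lambda\subset\mathcal K$, $P^*_\Lambda g:=\sum_{k\in\Lambda}\hat g_k\phi_k^*$. Matrix. $\mathbf A=(a_{\ell,k})_{\ell,k\in\mathcal K}$, $a_{\ell,k}=d_\ell^{-1/2}a(\phi_k,\phi_\ell)d_k^{-1/2}$, is a bounded invertible operator on $\ell^2(\mathcal K)$. Standing assumption: there are $c_L,\eta_L>0$ with $|a_{\ell,k}|\le c_Le^{-\eta_L|\ell-k|}$ for all $\ell,k$, and there are constants $C_{\mathbf A^{-1}},\tilde\eta_L>0$ such that for all $J\ge0$ $$\|\mathbf A^{-1}-(\mathbf A^{-1})_J\|\le C_{\mathbf A^{-1}}e^{-\tilde\eta_LJ}$$ in the operator norm of $\ell^2(\mathcal K)$, where $(\mathbf A^{-1})_J$ is obtained from $\mathbf A^{-1}$ by setting to zero the entries $(\ell,k)$ with $|\ell-k|>J$. Galerkin. For finite $\Lambda\subset\mathcal K$, $V_\Lambda=\mathrm{span}\{\phi_k:k\in\Lambda\}$, $u_\Lambda\in V_\Lambda$ solves $a(u_\Lambda,v)=\langle f,v\rangle$ for all $v\in V_\Lambda$, and the residual is $r(u_\Lambda)=f-Lu_\Lambda\in V^*$. Algorithm DYN-GAL($\varepsilon$). Set $\Lambda_0=\emptyset$, $u_0=0$, $r_0=f$. For $n=0,1,2,\dots$: let $\theta_n=(1-C_0^2\|r_n\|_{\phi^*}^2/\|r_0\|_{\phi^*}^2)^{1/2}$. (i) (Dörfler marking) Let $\widetilde{\partial\Lambda}_n\subset\mathcal K$ be a set of minimal cardinality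 such that $\|P^*_{\widetilde{\partial\Lambda}_n}r_n\|_{\phi^*}\ge\theta_n\|r_n\|_{\phi^*}$. (ii) (Enrichment) Let $J=J(\theta_n)>0$ satisfy $C_{\mathbf A^{-1}}e^{-\tilde\eta_LJ}\le\sqrt{\frac{1-\theta_n^2}{\alpha_*\alpha^*}}$; specifically, $J(\theta_n)=-\frac1{\tilde\eta_L}\log\frac{\|r_n\|_{\phi^*}}{\|r_0\|_{\phi^*}}+K_1$ with $K_1=-\frac1{\tilde\eta_L}\log\Big(\frac1{\sqrt{\alpha_*\alpha^*}}\frac{C_0}{C_{\mathbf A^{-1}}}\Big)+\delta_n$ and $\delta_n\in[0,1)$. Let $\partial\Lambda_n=\{k\in\mathcal K:\ |k-\ell|\le J\text{ for some }\ell\in\widetilde{\partial\Lambda}_n\}$. (iii) Set $\Lambda_{n+1}=\Lambda_n\cup\partial\Lambda_n$, $u_{n+1}=u_{\Lambda_{n+1}}$ (Galerkin solution), $r_{n+1}=r(u_{n+1})$. Stop as soon as $\|r_{n+1}\|_{\phi^*}\le\varepsilon\|r_0\|_{\phi^*}$. All residuals are assumed to be computed exactly.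
   Formalization: The formal theorem adds the assumption β_*β^* ≥ 1, a normalization of the weights d_k; without it the claim fails, since scaling the d_k down makes the enrichment radius J too small. *)

theory Defs
  imports "HOL-Analysis.Analysis" "HOL-Library.Function_Algebras"
begin

section \<open>The spaces H^1, H^1_0 and H^1_p\<close>

text \<open>
  An element of H^1 is represented by a pair (v, G) of a complex-valued function and its weak
  gradient. The gradient is determined by v up to a null set, and two pairs that agree almost
  everywhere have distance 0 in \<open>h1_norm\<close>; no quotient is taken. Sums and differences of such pairs
  are the componentwise, pointwise ones of Function_Algebras and Product_Plus.
\<close>

type_synonym 'n h1 = "(real^'n \<Rightarrow> complex) \<times> (real^'n \<Rightarrow> complex^'n)"

type_synonym 'n functional = "'n h1 \<Rightarrow> complex"

definition smult :: "complex \<Rightarrow> 'n::finite h1 \<Rightarrow> 'n h1" where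
  "smult c w = ((\<lambda>x. c * fst w x), (\<lambda>x. c *s snd w x))"

definition pderivative :: "'n::finite \<Rightarrow> (real^'n \<Rightarrow> complex) \<Rightarrow> real^'n \<Rightarrow> complex" where
  "pderivative i \<psi> x = frechet_derivative \<psi> (at x) (axis i 1)"

definition grad :: "(real^'n \<Rightarrow> complex) \<Rightarrow> real^'n \<Rightarrow> complex^'n::finite" where
  "grad \<psi> x = (\<chi> i. pderivative i \<psi> x)"

primrec times_differentiable :: "nat \<Rightarrow> (real^'n::finite \<Rightarrow> complex) \<Rightarrow> bool" where
  "times_differentiable 0 \<psi> \<longleftrightarrow> continuous_on UNIV \<psi>"
| "times_differentiable (Suc m) \<psi> \<longleftrightarrow>
     (\<forall>x. \<psi> differentiable (at x)) \<and> (\<forall>i. times_differentiable m (pderivative i \<psi>))"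

definition smooth :: "(real^'n::finite \<Rightarrow> complex) \<Rightarrow> bool" where
  "smooth \<psi> \<longleftrightarrow> (\<forall>m. times_differentiable m \<psi>)"

definition test_functions :: "(real^'n::finite) set \<Rightarrow> (real^'n \<Rightarrow> complex) set" where
  "test_functions \<Omega> =
     {\<psi>. smooth \<psi> \<and> compact (closure {x. \<psi> x \<noteq> 0}) \<and> closure {x. \<psi> x \<noteq> 0} \<subseteq> \<Omega>}"

text \<open>Smooth functions on the whole space that are periodic with cell \<open>box lo hi\<close>.\<close>

definition periodic_functions :: "real^'n \<Rightarrow> real^'n \<Rightarrow> (real^'n::finite \<Rightarrow> complex) set" where
  "periodic_functions lo hi =
     {\<psi>. smooth \<psi> \<and> (\<forall>x i. \<psi> (x + axis i (hi $ i - lo $ i)) = \<psi> x)}"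

definition square_integrable ::
    "(real^'n::finite) set \<Rightarrow> (real^'n \<Rightarrow> 'b::euclidean_space) \<Rightarrow> bool" where
  "square_integrable \<Omega> g \<longleftrightarrow>
     g \<in> borel_measurable (lebesgue_on \<Omega>) \<and> integrable (lebesgue_on \<Omega>) (\<lambda>x. (norm (g x))\<^sup>2)"

definition H1 :: "(real^'n::finite) set \<Rightarrow> 'n h1 set" where
  "H1 \<Omega> = {(v, G). square_integrable \<Omega> v \<and> square_integrable \<Omega> G \<and>
     (\<forall>\<psi>\<in>test_functions \<Omega>. \<forall>i.
        (LINT x|lebesgue_on \<Omega>. v x * pderivative i \<psi> x) =
        - (LINT x|lebesgue_on \<Omega>. G x $ i * \<psi> x))}"

definition h1_norm :: "(real^'n::finite) set \<Rightarrow> 'n h1 \<Rightarrow> real" where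
  "h1_norm \<Omega> w = sqrt ((LINT x|lebesgue_on \<Omega>. (norm (fst w x))\<^sup>2)
                     + (LINT x|lebesgue_on \<Omega>. (norm (snd w x))\<^sup>2))"

definition H1_closure :: "(real^'n::finite) set \<Rightarrow> (real^'n \<Rightarrow> complex) set \<Rightarrow> 'n h1 set" where
  "H1_closure \<Omega> D = {w \<in> H1 \<Omega>. \<forall>e>0. \<exists>\<psi>\<in>D. h1_norm \<Omega> (w - (\<psi>, grad \<psi>)) < e}"

definition H1_0 :: "(real^'n::finite) set \<Rightarrow> 'n h1 set" where
  "H1_0 \<Omega> = H1_closure \<Omega> (test_functions \<Omega>)"

definition H1_p :: "real^'n::finite \<Rightarrow> real^'n \<Rightarrow> 'n h1 set" where
  "H1_p lo hi = H1_closure (box lo hi) (periodic_functions lo hi)"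

section \<open>The variational problem\<close>

text \<open>
  The form a is conjugate-linear in its second argument, so the elements g of the dual space, which
  enter through \<open>a u v = g v\<close>, are the bounded conjugate-linear functionals.
\<close>

definition dual_space :: "(real^'n::finite) set \<Rightarrow> 'n h1 set \<Rightarrow> 'n functional set" where
  "dual_space \<Omega> V = {g.
     (\<forall>v\<in>V. \<forall>w\<in>V. g (v + w) = g v + g w) \<and>
     (\<forall>c. \<forall>v\<in>V. g (smult c v) = cnj c * g v) \<and>
     (\<exists>C. \<forall>v\<in>V. cmod (g v) \<le> C * h1_norm \<Omega> v)}"

definition energy_form :: "(real^'n::finite) set \<Rightarrow> (real^'n \<Rightarrow> real) \<Rightarrow> (real^'n \<Rightarrow> real)
    \<Rightarrow> 'n h1 \<Rightarrow> 'n h1 \<Rightarrow> complex" where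
  "energy_form \<Omega> \<nu> \<sigma> u v =
     (LINT x|lebesgue_on \<Omega>. of_real (\<nu> x) * (\<Sum>i\<in>UNIV. snd u x $ i * cnj (snd v x $ i)))
   + (LINT x|lebesgue_on \<Omega>. of_real (\<sigma> x) * fst u x * cnj (fst v x))"

definition energy_norm :: "('n::finite h1 \<Rightarrow> 'n h1 \<Rightarrow> complex) \<Rightarrow> 'n h1 \<Rightarrow> real" where
  "energy_norm a v = sqrt (Re (a v v))"

definition residual ::
    "('n::finite h1 \<Rightarrow> 'n h1 \<Rightarrow> complex) \<Rightarrow> 'n functional \<Rightarrow> 'n h1 \<Rightarrow> 'n functional" where
  "residual a f u = (\<lambda>v. f v - a u v)"

section \<open>Riesz basis, dual basis and the norm of the dual space\<close>

definition znorm :: "int^'n::finite \<Rightarrow> real" where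
  "znorm k = norm (\<chi> i. real_of_int (k $ i))"

definition expansion :: "(real^'n::finite) set \<Rightarrow> (int^'n) set \<Rightarrow> (int^'n \<Rightarrow> 'n h1)
    \<Rightarrow> 'n h1 \<Rightarrow> (int^'n \<Rightarrow> complex) \<Rightarrow> bool" where
  "expansion \<Omega> K \<phi> v c \<longleftrightarrow>
     ((\<lambda>F. h1_norm \<Omega> (v - (\<Sum>k\<in>F. smult (c k) (\<phi> k)))) \<longlongrightarrow> 0) (finite_subsets_at_top K)"

text \<open>The norm equivalence makes the coefficients of an expansion unique on K.\<close>

definition riesz_basis :: "(real^'n::finite) set \<Rightarrow> 'n h1 set \<Rightarrow> (int^'n) set
    \<Rightarrow> (int^'n \<Rightarrow> 'n h1) \<Rightarrow> (int^'n \<Rightarrow> real) \<Rightarrow> real \<Rightarrow> real \<Rightarrow> bool" where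
  "riesz_basis \<Omega> V K \<phi> d \<beta>\<^sub>l \<beta>\<^sub>u \<longleftrightarrow>
     (\<forall>k\<in>K. \<phi> k \<in> V \<and> d k > 0) \<and> 0 < \<beta>\<^sub>l \<and> \<beta>\<^sub>l \<le> \<beta>\<^sub>u \<and>
     (\<forall>v\<in>V. \<exists>c. expansion \<Omega> K \<phi> v c) \<and>
     (\<forall>v\<in>V. \<forall>c. expansion \<Omega> K \<phi> v c \<longrightarrow>
        (\<lambda>k. (cmod (c k))\<^sup>2 * d k) summable_on K \<and>
        \<beta>\<^sub>l * h1_norm \<Omega> v \<le> sqrt (\<Sum>\<^sub>\<infinity>k\<in>K. (cmod (c k))\<^sup>2 * d k) \<and>
        sqrt (\<Sum>\<^sub>\<infinity>k\<in>K. (cmod (c k))\<^sup>2 * d k) \<le> \<beta>\<^sub>u * h1_norm \<Omega> v)"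

definition coefficient :: "(real^'n::finite) set \<Rightarrow> (int^'n) set \<Rightarrow> (int^'n \<Rightarrow> 'n h1)
    \<Rightarrow> 'n h1 \<Rightarrow> int^'n \<Rightarrow> complex" where
  "coefficient \<Omega> K \<phi> v = (SOME c. expansion \<Omega> K \<phi> v c)"

text \<open>The conjugate makes the dual basis conjugate-linear; \<open>dual_basis \<Omega> K \<phi> k (\<phi> l)\<close> is 1 if k = l
  and 0 otherwise.\<close>

definition dual_basis :: "(real^'n::finite) set \<Rightarrow> (int^'n) set \<Rightarrow> (int^'n \<Rightarrow> 'n h1)
    \<Rightarrow> int^'n \<Rightarrow> 'n functional" where
  "dual_basis \<Omega> K \<phi> k = (\<lambda>v. cnj (coefficient \<Omega> K \<phi> v k))"

definition dual_projection :: "(real^'n::finite) set \<Rightarrow> (int^'n) set \<Rightarrow> (int^'n \<Rightarrow> 'n h1)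
    \<Rightarrow> (int^'n) set \<Rightarrow> 'n functional \<Rightarrow> 'n functional" where
  "dual_projection \<Omega> K \<phi> \<Lambda> g = (\<lambda>v. \<Sum>\<^sub>\<infinity>k\<in>\<Lambda>. g (\<phi> k) * dual_basis \<Omega> K \<phi> k v)"

definition dual_norm :: "(int^'n) set \<Rightarrow> (int^'n \<Rightarrow> 'n h1) \<Rightarrow> (int^'n \<Rightarrow> real)
    \<Rightarrow> 'n::finite functional \<Rightarrow> real" where
  "dual_norm K \<phi> d g = sqrt (\<Sum>\<^sub>\<infinity>k\<in>K. (cmod (g (\<phi> k)))\<^sup>2 / d k)"

section \<open>Matrices acting on l^2(K)\<close>

text \<open>Sequences over K are extended by 0 outside K.\<close>

definition l2 :: "'k set \<Rightarrow> ('k \<Rightarrow> complex) set" where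
  "l2 K = {x. (\<forall>k. k \<notin> K \<longrightarrow> x k = 0) \<and> (\<lambda>k. (cmod (x k))\<^sup>2) summable_on K}"

definition l2_norm :: "'k set \<Rightarrow> ('k \<Rightarrow> complex) \<Rightarrow> real" where
  "l2_norm K x = sqrt (\<Sum>\<^sub>\<infinity>k\<in>K. (cmod (x k))\<^sup>2)"

definition mat_apply :: "'k set \<Rightarrow> ('k \<Rightarrow> 'k \<Rightarrow> complex) \<Rightarrow> ('k \<Rightarrow> complex) \<Rightarrow> 'k \<Rightarrow> complex" where
  "mat_apply K M x = (\<lambda>l. if l \<in> K then \<Sum>\<^sub>\<infinity>k\<in>K. M l k * x k else 0)"

definition l2_bounded :: "'k set \<Rightarrow> ('k \<Rightarrow> 'k \<Rightarrow> complex) \<Rightarrow> bool" where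
  "l2_bounded K M \<longleftrightarrow>
     (\<forall>x\<in>l2 K. (\<forall>l\<in>K. (\<lambda>k. M l k * x k) summable_on K) \<and> mat_apply K M x \<in> l2 K) \<and>
     (\<exists>C. \<forall>x\<in>l2 K. l2_norm K (mat_apply K M x) \<le> C * l2_norm K x)"

definition l2_opnorm :: "'k set \<Rightarrow> ('k \<Rightarrow> 'k \<Rightarrow> complex) \<Rightarrow> real" where
  "l2_opnorm K M = (SUP x\<in>{x \<in> l2 K. l2_norm K x \<le> 1}. l2_norm K (mat_apply K M x))"

definition l2_inverse :: "'k set \<Rightarrow> ('k \<Rightarrow> 'k \<Rightarrow> complex) \<Rightarrow> ('k \<Rightarrow> 'k \<Rightarrow> complex) \<Rightarrow> bool" where
  "l2_inverse K M N \<longleftrightarrow> l2_bounded K M \<and> l2_bounded K N \<and>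
     (\<forall>x\<in>l2 K. mat_apply K M (mat_apply K N x) = x \<and> mat_apply K N (mat_apply K M x) = x)"

definition truncate :: "real \<Rightarrow> (int^'n::finite \<Rightarrow> int^'n \<Rightarrow> complex) \<Rightarrow> int^'n \<Rightarrow> int^'n \<Rightarrow> complex" where
  "truncate J M l k = (if znorm (l - k) > J then 0 else M l k)"

definition stiffness :: "('n::finite h1 \<Rightarrow> 'n h1 \<Rightarrow> complex) \<Rightarrow> (int^'n \<Rightarrow> 'n h1)
    \<Rightarrow> (int^'n \<Rightarrow> real) \<Rightarrow> int^'n \<Rightarrow> int^'n \<Rightarrow> complex" where
  "stiffness a \<phi> d l k = a (\<phi> k) (\<phi> l) / of_real (sqrt (d l) * sqrt (d k))"

section \<open>The algorithm DYN-GAL\<close>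

definition galerkin_space :: "(int^'n \<Rightarrow> 'n h1) \<Rightarrow> (int^'n) set \<Rightarrow> 'n::finite h1 set" where
  "galerkin_space \<phi> \<Lambda> = range (\<lambda>c. \<Sum>k\<in>\<Lambda>. smult (c k) (\<phi> k))"

definition galerkin_solution :: "('n::finite h1 \<Rightarrow> 'n h1 \<Rightarrow> complex) \<Rightarrow> 'n functional
    \<Rightarrow> (int^'n \<Rightarrow> 'n h1) \<Rightarrow> (int^'n) set \<Rightarrow> 'n h1 \<Rightarrow> bool" where
  "galerkin_solution a f \<phi> \<Lambda> w \<longleftrightarrow>
     w \<in> galerkin_space \<phi> \<Lambda> \<and> (\<forall>v\<in>galerkin_space \<phi> \<Lambda>. a w v = f v)"

text \<open>Finiteness is required explicitly because \<open>card\<close> is 0 on infinite sets.\<close>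

definition doerfler_set :: "(real^'n::finite) set \<Rightarrow> (int^'n) set \<Rightarrow> (int^'n \<Rightarrow> 'n h1)
    \<Rightarrow> (int^'n \<Rightarrow> real) \<Rightarrow> real \<Rightarrow> 'n functional \<Rightarrow> (int^'n) set \<Rightarrow> bool" where
  "doerfler_set \<Omega> K \<phi> d \<theta> g M \<longleftrightarrow>
     finite M \<and> M \<subseteq> K \<and> dual_norm K \<phi> d (dual_projection \<Omega> K \<phi> M g) \<ge> \<theta> * dual_norm K \<phi> d g"

definition doerfler_marking :: "(real^'n::finite) set \<Rightarrow> (int^'n) set \<Rightarrow> (int^'n \<Rightarrow> 'n h1)
    \<Rightarrow> (int^'n \<Rightarrow> real) \<Rightarrow> real \<Rightarrow> 'n functional \<Rightarrow> (int^'n) set \<Rightarrow> bool" where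
  "doerfler_marking \<Omega> K \<phi> d \<theta> g M \<longleftrightarrow> doerfler_set \<Omega> K \<phi> d \<theta> g M \<and>
     (\<forall>M'. doerfler_set \<Omega> K \<phi> d \<theta> g M' \<longrightarrow> card M \<le> card M')"

definition enrichment :: "(int^'n::finite) set \<Rightarrow> real \<Rightarrow> (int^'n) set \<Rightarrow> (int^'n) set" where
  "enrichment K J M = {k \<in> K. \<exists>l\<in>M. znorm (k - l) \<le> J}"

text \<open>One pass through the loop, from \<open>(\<Lambda>, r)\<close> to \<open>(\<Lambda>', u', r')\<close>. The constants \<open>C\<^sub>A\<close> and \<open>\<eta>\<^sub>A\<close>
  are those of the decay estimate for the inverse of the stiffness matrix.

  Pitfall: replacing d by t d multiplies the inverse matrix, and so the admissible \<open>C\<^sub>A\<close>, by t, while the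
  quotients of residual norms, \<open>C\<^sub>0\<close> and \<open>\<alpha>\<^sub>l, \<alpha>\<^sub>u\<close> do not change. The radius J thus depends on the scaling
  of the weights and is too small for quadratic convergence if d is scaled too far down. Statements about
  the algorithm fix the scaling by \<open>1 \<le> \<beta>\<^sub>l * \<beta>\<^sub>u\<close>, which holds for t d in place of d once t is large
  enough, as the Riesz constants are multiplied by \<open>sqrt t\<close>.\<close>

definition dyn_gal_step where
  "dyn_gal_step \<Omega> a f K \<phi> d \<alpha>\<^sub>l \<alpha>\<^sub>u C\<^sub>A \<eta>\<^sub>A C\<^sub>0 \<Lambda> r \<Lambda>' u' r' \<longleftrightarrow>
     (let \<theta> = sqrt (1 - C\<^sub>0\<^sup>2 * (dual_norm K \<phi> d r)\<^sup>2 / (dual_norm K \<phi> d f)\<^sup>2) in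
      \<exists>M J \<delta>.
        doerfler_marking \<Omega> K \<phi> d \<theta> r M \<and>
        0 < J \<and> C\<^sub>A * exp (- \<eta>\<^sub>A * J) \<le> sqrt ((1 - \<theta>\<^sup>2) / (\<alpha>\<^sub>l * \<alpha>\<^sub>u)) \<and>
        0 \<le> \<delta> \<and> \<delta> < 1 \<and>
        J = - (1 / \<eta>\<^sub>A) * ln (dual_norm K \<phi> d r / dual_norm K \<phi> d f)
            + (- (1 / \<eta>\<^sub>A) * ln (1 / sqrt (\<alpha>\<^sub>l * \<alpha>\<^sub>u) * (C\<^sub>0 / C\<^sub>A)) + \<delta>) \<and>
        \<Lambda>' = \<Lambda> \<union> enrichment K J M \<and>
        galerkin_solution a f \<phi> \<Lambda>' u' \<and>
        r' = residual a f u')"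

text \<open>Pass n is executed (and \<open>u (Suc n)\<close> is generated) iff none of the stopping tests of the
  preceding passes succeeded.\<close>

definition executed ::
    "(int^'n) set \<Rightarrow> (int^'n \<Rightarrow> 'n h1) \<Rightarrow> (int^'n \<Rightarrow> real) \<Rightarrow> real
    \<Rightarrow> (nat \<Rightarrow> 'n::finite functional) \<Rightarrow> nat \<Rightarrow> bool" where
  "executed K \<phi> d \<epsilon> r n \<longleftrightarrow>
     (\<forall>m<n. \<not> dual_norm K \<phi> d (r (Suc m)) \<le> \<epsilon> * dual_norm K \<phi> d (r 0))"

text \<open>The sequences are unconstrained beyond the last pass that is executed.\<close>

definition dyn_gal_run where
  "dyn_gal_run \<Omega> a f K \<phi> d \<alpha>\<^sub>l \<alpha>\<^sub>u C\<^sub>A \<eta>\<^sub>A C\<^sub>0 \<epsilon> \<Lambda> u r \<longleftrightarrow>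
     \<Lambda> 0 = {} \<and> u 0 = 0 \<and> r 0 = f \<and>
     (\<forall>n. executed K \<phi> d \<epsilon> r n \<longrightarrow>
        dyn_gal_step \<Omega> a f K \<phi> d \<alpha>\<^sub>l \<alpha>\<^sub>u C\<^sub>A \<eta>\<^sub>A C\<^sub>0
          (\<Lambda> n) (r n) (\<Lambda> (Suc n)) (u (Suc n)) (r (Suc n)))"

end

theory Submission
  imports Defs
begin

text \<open>
  Let \<open>e\<close> be the error and \<open>b\<close> the coefficients of the residual. With the marked part of \<open>b\<close>
  inserted, the truncated inverse matrix yields an element of the new Galerkin space, so Galerkin
  optimality bounds the new energy error by that of this correction. What the correction misses is
  the unmarked part of \<open>b\<close>, of relative size \<open>sqrt (1 - \<theta>\<^sup>2)\<close>, and the truncation error of the inverse,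
  which the choice of \<open>J\<close> makes equally small. Since \<open>sqrt (1 - \<theta>\<^sup>2)\<close> is itself proportional to the
  relative residual, the new error is quadratic in the old residual; the equivalence of energy error
  and residual turns this into quadratic convergence of either.
\<close>

section \<open>Square-summable sequences\<close>

text \<open>Put q = \<open>sqrt \<alpha>\<^sub>u / \<beta>\<^sub>l\<close>, the factor bounding a
  residual by its energy error. One step bounds the new energy error by c times the squared old
  residual over the initial one, with c =
  \<open>2 * (\<beta>\<^sub>u / sqrt \<alpha>\<^sub>l) * C\<^sub>0\<close>; the 2 counts the
  unmarked part and the truncation error. The bound on \<open>C\<^sub>0\<close> says exactly that c
  q is at most 1/2. Applying q to the new error gives the residual estimate; applying q to the old
  error, squared, gives the energy estimate, where one q goes into c q and the other into
  \<open>C\<^sub>1\<close>. The truncation error arises with 1 / \<open>\<beta>\<^sub>l\<close> in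
  place of \<open>\<beta>\<^sub>u\<close>, and
  \<open>1 \<le> \<beta>\<^sub>l * \<beta>\<^sub>u\<close> makes the two contributions comparable.
  Two obstacles shape the setting: pairs equal almost everywhere are distinct, so all forms are
  merely semidefinite; and completeness of \<open>V\<close> is not established, so infinite
  coefficient sequences are handled through finite sections and their limits.\<close>

lemma l2_norm_bounded_partial_sums:
  assumes "\<And>F. finite F \<Longrightarrow> F \<subseteq> K \<Longrightarrow> L2_set (\<lambda>k. cmod (x k)) F \<le> B"
  shows "(\<lambda>k. (cmod (x k))\<^sup>2) summable_on K" and "l2_norm K x \<le> B"
proof -
  \<comment> \<open>The empty section forces the sign of \<open>B\<close>, so that the bound may be
    squared.\<close>
  have B: "0 \<le> B"
    using assms[of "{}"] by simp
  have fin: "(\<Sum>k\<in>F. (cmod (x k))\<^sup>2) \<le> B\<^sup>2" if "finite F" "F \<subseteq> K" for F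
    using assms[OF that] B by (simp add: L2_set_def sqrt_le_D)
  show s: "(\<lambda>k. (cmod (x k))\<^sup>2) summable_on K"
    by (rule nonneg_bounded_partial_sums_imp_summable_on[where C = "B\<^sup>2"])
       (auto intro!: eventually_finite_subsets_at_top_weakI fin)
  have "(\<Sum>\<^sub>\<infinity>k\<in>K. (cmod (x k))\<^sup>2) \<le> B\<^sup>2"
    by (rule infsum_le_finite_sums[OF s fin])
  then show "l2_norm K x \<le> B"
    unfolding l2_norm_def using B by (simp add: real_le_lsqrt)
qed

lemma L2_set_le_l2_norm:
  assumes "(\<lambda>k. (cmod (x k))\<^sup>2) summable_on K" "finite F" "F \<subseteq> K"
  shows "L2_set (\<lambda>k. cmod (x k)) F \<le> l2_norm K x"
  unfolding L2_set_def l2_norm_def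
  by (intro real_sqrt_le_mono finite_sum_le_infsum assms) auto

lemma l2_norm_nonneg: "0 \<le> l2_norm K x"
  by (simp add: l2_norm_def infsum_nonneg)

lemma l2_norm_cong:
  assumes "\<And>k. k \<in> K \<Longrightarrow> cmod (x k) = cmod (y k)"
  shows "l2_norm K x = l2_norm K y"
  unfolding l2_norm_def by (rule arg_cong[where f = sqrt], rule infsum_cong) (simp add: assms)

text \<open>Minkowski's inequality on a finite section has a right-hand side independent of the
  section, which yields summability and the norm bound together.\<close>

lemma l2_norm_add:
  assumes "(\<lambda>k. (cmod (x k))\<^sup>2) summable_on K" "(\<lambda>k. (cmod (y k))\<^sup>2) summable_on K"
  shows "(\<lambda>k. (cmod (x k + y k))\<^sup>2) summable_on K"
    and "l2_norm K (\<lambda>k. x k + y k) \<le> l2_norm K x + l2_norm K y"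
proof -
  have *: "L2_set (\<lambda>k. cmod (x k + y k)) F \<le> l2_norm K x + l2_norm K y"
    if "finite F" "F \<subseteq> K" for F
  proof -
    have "L2_set (\<lambda>k. cmod (x k + y k)) F \<le> L2_set (\<lambda>k. cmod (x k) + cmod (y k)) F"
      by (rule L2_set_mono) (auto intro: norm_triangle_ineq)
    also have "\<dots> \<le> L2_set (\<lambda>k. cmod (x k)) F + L2_set (\<lambda>k. cmod (y k)) F"
      by (rule L2_set_triangle_ineq)
    also have "\<dots> \<le> l2_norm K x + l2_norm K y"
      by (intro add_mono L2_set_le_l2_norm assms that)
    finally show ?thesis .
  qed
  show "(\<lambda>k. (cmod (x k + y k))\<^sup>2) summable_on K"
    by (rule l2_norm_bounded_partial_sums(1)[OF *])
  show "l2_norm K (\<lambda>k. x k + y k) \<le> l2_norm K x + l2_norm K y"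
    by (rule l2_norm_bounded_partial_sums(2)[OF *])
qed

lemma l2_norm_smult: "l2_norm K (\<lambda>k. c * x k) = cmod c * l2_norm K x"
  unfolding l2_norm_def
  by (simp add: norm_mult power_mult_distrib infsum_cmult_right' real_sqrt_mult)

lemma l2_norm_mono_set:
  assumes "(\<lambda>k. (cmod (x k))\<^sup>2) summable_on K" "L \<subseteq> K"
  shows "l2_norm L x \<le> l2_norm K x"
  by (rule l2_norm_bounded_partial_sums) (use assms in \<open>auto intro: L2_set_le_l2_norm\<close>)

lemma l2_norm_restrict:
  assumes "L \<subseteq> K"
  shows "l2_norm K (\<lambda>k. if k \<in> L then x k else 0) = l2_norm L x"
  unfolding l2_norm_def
  by (rule arg_cong[where f = sqrt], rule infsum_cong_neutral) (use assms in auto)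

lemma l2_restrict:
  assumes "(\<lambda>k. (cmod (x k))\<^sup>2) summable_on K" "L \<subseteq> K"
  shows "(\<lambda>k. if k \<in> L then x k else 0) \<in> l2 K"
proof -
  have "(\<lambda>k. (cmod (x k))\<^sup>2) summable_on L"
    using assms summable_on_subset_banach by blast
  then have "(\<lambda>k. (cmod (if k \<in> L then x k else 0))\<^sup>2) summable_on K"
    by (rule summable_on_cong_neutral[THEN iffD1, rotated -1]) (use assms in auto)
  then show ?thesis
    using assms by (auto simp: l2_def)
qed

lemma l2_norm_split:
  assumes "(\<lambda>k. (cmod (x k))\<^sup>2) summable_on K" "L \<subseteq> K"
  shows "(l2_norm (K - L) x)\<^sup>2 = (l2_norm K x)\<^sup>2 - (l2_norm L x)\<^sup>2"
proof -
  have "(\<lambda>k. (cmod (x k))\<^sup>2) summable_on L"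
    using assms summable_on_subset_banach by blast
  then have "(\<Sum>\<^sub>\<infinity>k\<in>K - L. (cmod (x k))\<^sup>2) = (\<Sum>\<^sub>\<infinity>k\<in>K. (cmod (x k))\<^sup>2) - (\<Sum>\<^sub>\<infinity>k\<in>L. (cmod (x k))\<^sup>2)"
    by (rule infsum_Diff[OF assms(1) _ assms(2)])
  moreover have "(l2_norm L' x)\<^sup>2 = (\<Sum>\<^sub>\<infinity>k\<in>L'. (cmod (x k))\<^sup>2)" for L'
    by (simp add: l2_norm_def infsum_nonneg)
  ultimately show ?thesis
    by simp
qed

text \<open>The squared tail is the total minus the partial sum. This limit later removes the error
  made by cutting a coefficient sequence to a finite section.\<close>

lemma l2_norm_tail:
  assumes "(\<lambda>k. (cmod (x k))\<^sup>2) summable_on K"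
  shows "((\<lambda>F. l2_norm (K - F) x) \<longlongrightarrow> 0) (finite_subsets_at_top K)"
proof -
  have "((\<lambda>F. \<Sum>k\<in>F. (cmod (x k))\<^sup>2) \<longlongrightarrow> (\<Sum>\<^sub>\<infinity>k\<in>K. (cmod (x k))\<^sup>2)) (finite_subsets_at_top K)"
    by (rule infsum_tendsto[OF assms])
  then have "((\<lambda>F. sqrt ((\<Sum>\<^sub>\<infinity>k\<in>K. (cmod (x k))\<^sup>2) - (\<Sum>k\<in>F. (cmod (x k))\<^sup>2))) \<longlongrightarrow>
      sqrt ((\<Sum>\<^sub>\<infinity>k\<in>K. (cmod (x k))\<^sup>2) - (\<Sum>\<^sub>\<infinity>k\<in>K. (cmod (x k))\<^sup>2))) (finite_subsets_at_top K)"
    by (intro tendsto_intros)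
  moreover have "\<forall>\<^sub>F F in finite_subsets_at_top K.
      sqrt ((\<Sum>\<^sub>\<infinity>k\<in>K. (cmod (x k))\<^sup>2) - (\<Sum>k\<in>F. (cmod (x k))\<^sup>2)) = l2_norm (K - F) x"
    by (rule eventually_finite_subsets_at_top_weakI)
       (use assms in \<open>simp add: l2_norm_def infsum_Diff\<close>)
  ultimately show ?thesis
    by (simp add: tendsto_cong)
qed

lemma l2_norm_eq_0:
  assumes "(\<lambda>k. (cmod (x k))\<^sup>2) summable_on K" "l2_norm K x \<le> 0" "k \<in> K"
  shows "x k = 0"
proof -
  have "cmod (x k) \<le> l2_norm K x"
    using L2_set_le_l2_norm[OF assms(1), of "{k}"] assms(3) by simp
  then have "cmod (x k) \<le> 0"
    using assms(2) by linarith
  then show ?thesis by simp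
qed

section \<open>Matrices acting on square-summable sequences\<close>

lemma mat_apply_finite:
  assumes "finite M" "M \<subseteq> K" "\<And>k. k \<in> K - M \<Longrightarrow> x k = 0" "l \<in> K"
  shows "mat_apply K N x l = (\<Sum>k\<in>M. N l k * x k)"
proof -
  have "(\<Sum>\<^sub>\<infinity>k\<in>K. N l k * x k) = (\<Sum>\<^sub>\<infinity>k\<in>M. N l k * x k)"
    by (rule infsum_cong_neutral) (use assms in auto)
  then show ?thesis
    using assms by (simp add: mat_apply_def)
qed

text \<open>\<open>infsum\<close> is additive only on convergent series; the rowwise summability
  contained in \<open>l2_bounded\<close> supplies the convergence.\<close>

lemma mat_apply_diff:
  assumes "l2_bounded K N" "x \<in> l2 K" "y \<in> l2 K" "l \<in> K"
  shows "mat_apply K N (\<lambda>k. x k - y k) l = mat_apply K N x l - mat_apply K N y l"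
proof -
  have "(\<lambda>k. N l k * x k) summable_on K" "(\<lambda>k. N l k * y k) summable_on K"
    using assms by (auto simp: l2_bounded_def)
  then show ?thesis
    using assms(4) infsum_add[of "\<lambda>k. N l k * x k" K "\<lambda>k. - (N l k * y k)"]
    by (simp add: mat_apply_def right_diff_distrib infsum_uminus summable_on_uminus)
qed

text \<open>Scaling to norm 1 brings \<open>x\<close> into the set whose supremum is
  \<open>l2_opnorm\<close>. A real supremum bounds its members only if the set is bounded above,
  which the constant in \<open>l2_bounded\<close> guarantees; it also settles norm 0, where scaling
  is impossible.\<close>

lemma l2_norm_mat_apply_le:
  assumes "l2_bounded K N" "x \<in> l2 K"
  shows "l2_norm K (mat_apply K N x) \<le> l2_opnorm K N * l2_norm K x"
proof -
  let ?c = "l2_norm K x"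
  obtain C where C: "\<And>x. x \<in> l2 K \<Longrightarrow> l2_norm K (mat_apply K N x) \<le> C * l2_norm K x"
    using assms(1) by (auto simp: l2_bounded_def)
  show ?thesis
  proof (cases "?c = 0")
    case True
    then show ?thesis using C[OF assms(2)] by simp
  next
    case False
    then have c: "0 < ?c"
      using l2_norm_nonneg[of K x] by linarith
    define y where "y = (\<lambda>k. complex_of_real (1 / ?c) * x k)"
    have y1: "l2_norm K y = 1"
      unfolding y_def l2_norm_smult using c by (simp add: norm_divide)
    have "(\<lambda>k. (cmod (y k))\<^sup>2) = (\<lambda>k. (1 / ?c)\<^sup>2 * (cmod (x k))\<^sup>2)"
      by (auto simp: y_def norm_mult norm_divide power_mult_distrib power_divide)
    then have y: "y \<in> l2 K"
      using assms(2) by (auto simp: l2_def y_def intro!: summable_on_cmult_right)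
    have "mat_apply K N y = (\<lambda>l. complex_of_real (1 / ?c) * mat_apply K N x l)"
      unfolding mat_apply_def y_def mult.left_commute[of "N _ _" "complex_of_real (1 / ?c)"]
        infsum_cmult_right'
      by (simp add: fun_eq_iff)
    then have "l2_norm K (mat_apply K N x) / ?c = l2_norm K (mat_apply K N y)"
      using c by (simp only: l2_norm_smult) (simp add: norm_divide)
    also have "\<dots> \<le> l2_opnorm K N"
      unfolding l2_opnorm_def
    proof (rule cSUP_upper)
      show "bdd_above ((\<lambda>x. l2_norm K (mat_apply K N x)) ` {x \<in> l2 K. l2_norm K x \<le> 1})"
      proof (rule bdd_aboveI2)
        fix z assume z: "z \<in> {x \<in> l2 K. l2_norm K x \<le> 1}"
        have "l2_norm K (mat_apply K N z) \<le> C * l2_norm K z"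
          using C z by auto
        \<comment> \<open>The sign of \<open>C\<close> is unknown, hence the absolute value.\<close>
        also have "\<dots> \<le> \<bar>C\<bar> * 1"
          using z l2_norm_nonneg[of K z] by (intro mult_mono) auto
        finally show "l2_norm K (mat_apply K N z) \<le> \<bar>C\<bar> * 1" .
      qed
    qed (use y y1 in auto)
    finally show ?thesis
      using c by (simp add: divide_simps)
  qed
qed

section \<open>Hermitian forms\<close>

lemma smult_diff_left: "smult (b - c) w = smult b w - smult c w"
  by (simp add: smult_def prod_eq_iff fun_eq_iff vec_eq_iff algebra_simps)

lemma smult_add_right: "smult c (v + w) = smult c v + smult c w"
  by (simp add: smult_def prod_eq_iff fun_eq_iff vec_eq_iff algebra_simps)

lemma smult_add_left: "smult (b + c) w = smult b w + smult c w"
  by (simp add: smult_def prod_eq_iff fun_eq_iff vec_eq_iff algebra_simps)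

lemma smult_smult: "smult b (smult c w) = smult (b * c) w"
  by (simp add: smult_def prod_eq_iff fun_eq_iff vec_eq_iff algebra_simps)

lemma smult_minus_one: "smult (-1) w = - w"
  by (simp add: smult_def prod_eq_iff fun_eq_iff vec_eq_iff)

lemma smult_one: "smult 1 w = w"
  by (simp add: smult_def prod_eq_iff fun_eq_iff vec_eq_iff)

lemma smult_zero: "smult 0 w = 0"
  by (simp add: smult_def prod_eq_iff fun_eq_iff vec_eq_iff)

lemma smult_sum: "smult c (\<Sum>k\<in>F. g k) = (\<Sum>k\<in>F. smult c (g k))"
  using smult_zero[of 0]
  by (induction F rule: infinite_finite_induct)
     (auto simp: smult_add_right, simp_all add: smult_def prod_eq_iff fun_eq_iff vec_eq_iff)

text \<open>Scalars are complex and act through \<open>smult\<close> on pairs of functions, so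
  linearity of a set is phrased with that operation.\<close>

definition smult_subspace :: "'n::finite h1 set \<Rightarrow> bool" where
  "smult_subspace V \<longleftrightarrow>
     0 \<in> V \<and> (\<forall>v\<in>V. \<forall>w\<in>V. v + w \<in> V) \<and> (\<forall>c. \<forall>v\<in>V. smult c v \<in> V)"

lemma smult_subspaceD:
  assumes "smult_subspace V"
  shows "0 \<in> V" "\<And>v w. v \<in> V \<Longrightarrow> w \<in> V \<Longrightarrow> v + w \<in> V" "\<And>c v. v \<in> V \<Longrightarrow> smult c v \<in> V"
    "\<And>v. v \<in> V \<Longrightarrow> - v \<in> V" "\<And>v w. v \<in> V \<Longrightarrow> w \<in> V \<Longrightarrow> v - w \<in> V"
    "\<And>F g. (\<And>k. k \<in> F \<Longrightarrow> g k \<in> V) \<Longrightarrow> sum g F \<in> V"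
proof -
  show 1: "0 \<in> V" "\<And>v w. v \<in> V \<Longrightarrow> w \<in> V \<Longrightarrow> v + w \<in> V" "\<And>c v. v \<in> V \<Longrightarrow> smult c v \<in> V"
    using assms by (auto simp: smult_subspace_def)
  show 2: "- v \<in> V" if "v \<in> V" for v
    using 1(3)[OF that, of "-1"] by (simp add: smult_minus_one)
  show "v - w \<in> V" if "v \<in> V" "w \<in> V" for v w
    using 1(2)[OF that(1) 2[OF that(2)]] by simp
  show "sum g F \<in> V" if "\<And>k. k \<in> F \<Longrightarrow> g k \<in> V" for F and g :: "'b \<Rightarrow> 'a h1"
    using that by (induction F rule: infinite_finite_induct) (auto intro: 1)
qed

text \<open>Cancels the common factor at the end of a duality argument, including the case where
  that factor is 0.\<close>

lemma le_if_square_le_mult: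
  fixes s c :: real
  assumes "s\<^sup>2 \<le> c * s" "0 \<le> c"
  shows "s \<le> c"
  using assms by (cases "s \<le> 0") (auto simp: power2_eq_square)

text \<open>Positivity is only semidefinite: a pair vanishing almost everywhere has energy 0 without
  being 0. Linearity in the second argument, up to conjugation, follows from
  \<open>hermitian\<close>.\<close>

locale hermitian_form =
  fixes V :: "'n::finite h1 set" and b :: "'n h1 \<Rightarrow> 'n h1 \<Rightarrow> complex"
  assumes subspace: "smult_subspace V"
    and add_left: "u \<in> V \<Longrightarrow> v \<in> V \<Longrightarrow> w \<in> V \<Longrightarrow> b (u + v) w = b u w + b v w"
    and smult_left: "v \<in> V \<Longrightarrow> w \<in> V \<Longrightarrow> b (smult c v) w = c * b v w"
    and hermitian: "v \<in> V \<Longrightarrow> w \<in> V \<Longrightarrow> b w v = cnj (b v w)"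
    and nonneg: "v \<in> V \<Longrightarrow> 0 \<le> Re (b v v)"
begin

lemmas closed = smult_subspaceD[OF subspace]

lemma add_right: "u \<in> V \<Longrightarrow> v \<in> V \<Longrightarrow> w \<in> V \<Longrightarrow> b w (u + v) = b w u + b w v"
  using hermitian[of "u + v" w] hermitian[of u w] hermitian[of v w] add_left[of u v w] closed
  by simp

lemma smult_right: "v \<in> V \<Longrightarrow> w \<in> V \<Longrightarrow> b w (smult c v) = cnj c * b w v"
  using hermitian[of "smult c v" w] hermitian[of v w] smult_left[of v w c] closed
  by simp

lemma diff_left: "u \<in> V \<Longrightarrow> v \<in> V \<Longrightarrow> w \<in> V \<Longrightarrow> b (u - v) w = b u w - b v w"
  using add_left[of u "- v" w] smult_left[of v w "-1"] closed by (simp add: smult_minus_one)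

lemma zero_left: "v \<in> V \<Longrightarrow> b 0 v = 0"
  using smult_left[of v v 0] by (simp add: smult_zero)

lemma zero_right: "v \<in> V \<Longrightarrow> b v 0 = 0"
  using smult_right[of v v 0] by (simp add: smult_zero)

lemma sum_left: "w \<in> V \<Longrightarrow> (\<And>k. k \<in> F \<Longrightarrow> g k \<in> V) \<Longrightarrow> b (sum g F) w = (\<Sum>k\<in>F. b (g k) w)"
  by (induction F rule: infinite_finite_induct) (auto simp: zero_left add_left closed)

lemma sum_right: "w \<in> V \<Longrightarrow> (\<And>k. k \<in> F \<Longrightarrow> g k \<in> V) \<Longrightarrow> b w (sum g F) = (\<Sum>k\<in>F. b w (g k))"
  by (induction F rule: infinite_finite_induct) (auto simp: zero_right add_right closed)

lemma energy_norm_nonneg: "v \<in> V \<Longrightarrow> 0 \<le> energy_norm b v"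
  by (simp add: energy_norm_def nonneg)

lemma self_eq: "v \<in> V \<Longrightarrow> b v v = of_real ((energy_norm b v)\<^sup>2)"
  using hermitian[of v v] nonneg[of v] by (simp add: energy_norm_def complex_eq_iff)

lemma energy_norm_zero: "energy_norm b 0 = 0"
  using zero_left[OF closed(1)] by (simp add: energy_norm_def)

text \<open>The common source of Cauchy-Schwarz, of the triangle inequality (\<open>t = 1\<close>)
  and of homogeneity (\<open>v = 0\<close>).\<close>

lemma quadratic_expansion:
  assumes "v \<in> V" "w \<in> V"
  shows "(energy_norm b (v + smult t w))\<^sup>2 =
    (energy_norm b v)\<^sup>2 + 2 * Re (cnj t * b v w) + (cmod t)\<^sup>2 * (energy_norm b w)\<^sup>2"
proof -
  have "b (v + smult t w) (v + smult t w) =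
      b v v + cnj t * b v w + t * cnj (b v w) + t * cnj t * b w w"
    using assms closed(2,3)
    by (simp add: add_left add_right smult_left smult_right algebra_simps hermitian[of v w])
  moreover have "Re (t * cnj (b v w)) = Re (cnj t * b v w)"
    by simp
  moreover have "t * cnj t * b w w = of_real ((cmod t)\<^sup>2 * (energy_norm b w)\<^sup>2)"
    using self_eq[OF assms(2)] complex_norm_square[of t] by simp
  ultimately show ?thesis
    using nonneg[of "v + smult t w"] nonneg[OF assms(1)] assms closed
    by (simp add: energy_norm_def)
qed

lemma Cauchy_Schwarz:
  assumes "v \<in> V" "w \<in> V"
  shows "cmod (b v w) \<le> energy_norm b v * energy_norm b w"
proof -
  let ?z = "b v w" and ?p = "(energy_norm b v)\<^sup>2" and ?q = "(energy_norm b w)\<^sup>2"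
  \<comment> \<open>This is the expansion at \<open>t = - s * b v w\<close>, a choice that makes the
    cross term real.\<close>
  have *: "0 \<le> ?p - 2 * s * (cmod ?z)\<^sup>2 + s\<^sup>2 * (cmod ?z)\<^sup>2 * ?q" for s :: real
  proof -
    have "cnj (- of_real s * ?z) * ?z = of_real (- s * (cmod ?z)\<^sup>2)"
      using complex_norm_square[of ?z] by (simp add: mult.commute)
    then have "Re (cnj (- of_real s * ?z) * ?z) = - s * (cmod ?z)\<^sup>2"
      by (metis Re_complex_of_real)
    then show ?thesis
      using quadratic_expansion[OF assms, of "- of_real s * ?z"]
        zero_le_power2[of "energy_norm b (v + smult (- of_real s * ?z) w)"]
      by (simp add: norm_mult power_mult_distrib)
  qed
  have "(cmod ?z)\<^sup>2 \<le> ?p * ?q"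
  \<comment> \<open>Semidefiniteness makes this case genuine: the quadratic in \<open>s\<close>
    degenerates to a linear function, which a large \<open>s\<close> makes negative unless
    \<open>b v w\<close> vanishes.\<close>
  proof (cases "?q = 0")
    case True
    have "cmod ?z = 0"
    proof (rule ccontr)
      assume "cmod ?z \<noteq> 0"
      then show False
        using *[of "(?p + 1) / (2 * (cmod ?z)\<^sup>2)"] True by (simp add: field_simps)
    qed
    then show ?thesis by simp
  next
    case False
    then have "0 < ?q" by simp
    \<comment> \<open>The value \<open>s = 1 / ?q\<close> minimises the quadratic.\<close>
    have "0 \<le> ?p - 2 * (1 / ?q) * (cmod ?z)\<^sup>2 + (1 / ?q)\<^sup>2 * (cmod ?z)\<^sup>2 * ?q"
      by (rule *)
    also have "\<dots> = ?p - (cmod ?z)\<^sup>2 / ?q"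
      using False by (simp add: power2_eq_square divide_simps)
    finally show ?thesis
      using \<open>0 < ?q\<close> by (simp add: field_simps)
  qed
  then have "cmod ?z \<le> sqrt (?p * ?q)"
    by (simp add: real_le_rsqrt)
  then show ?thesis
    using assms by (simp add: real_sqrt_mult energy_norm_nonneg)
qed

lemma energy_norm_triangle:
  assumes "v \<in> V" "w \<in> V"
  shows "energy_norm b (v + w) \<le> energy_norm b v + energy_norm b w"
proof -
  have "(energy_norm b (v + w))\<^sup>2 = (energy_norm b v)\<^sup>2 + 2 * Re (b v w) + (energy_norm b w)\<^sup>2"
    using quadratic_expansion[OF assms, of 1] by (simp add: smult_one)
  also have "\<dots> \<le> (energy_norm b v + energy_norm b w)\<^sup>2"
    using Cauchy_Schwarz[OF assms] complex_Re_le_cmod[of "b v w"] by (simp add: power2_sum)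
  finally show ?thesis
    by (rule power2_le_imp_le) (intro add_nonneg_nonneg energy_norm_nonneg assms)
qed

lemma energy_norm_smult: "v \<in> V \<Longrightarrow> energy_norm b (smult c v) = cmod c * energy_norm b v"
  using quadratic_expansion[of 0 v c] closed(1) closed(3)[of v c] energy_norm_nonneg[of v]
    energy_norm_nonneg[of "smult c v"]
  by (simp add: energy_norm_zero zero_left flip: power_mult_distrib)

lemma energy_norm_diff_triangle:
  assumes "v \<in> V" "w \<in> V"
  shows "energy_norm b (v - w) \<le> energy_norm b v + energy_norm b w"
  using energy_norm_triangle[of v "- w"] energy_norm_smult[of w "-1"] assms closed
  by (simp add: smult_minus_one)

text \<open>Galerkin orthogonality of \<open>u - w\<close> to \<open>v - w\<close> allows replacing
  one \<open>u - w\<close> by \<open>u - v\<close> in the squared error. Cauchy-Schwarz for the form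
  itself then gives the constant 1.\<close>

lemma best_approximation:
  assumes "smult_subspace W" "W \<subseteq> V" "u \<in> V" "w \<in> W" "\<And>v. v \<in> W \<Longrightarrow> b w v = b u v" "v \<in> W"
  shows "energy_norm b (u - w) \<le> energy_norm b (u - v)"
proof -
  have mem: "w \<in> V" "v \<in> V" "v - w \<in> W" "u - w \<in> V" "u - v \<in> V" "v - w \<in> V"
    using assms(2-4,6) smult_subspaceD(5)[OF assms(1)] closed(5) by (simp_all add: subset_eq)
  have "b (u - w) (v - w) = 0"
    using mem assms(3,5) by (simp add: diff_left)
  then have "b (u - w) (u - w) = b (u - w) (u - v)"
    using add_right[of "u - v" "v - w" "u - w"] mem by simp
  then have "(energy_norm b (u - w))\<^sup>2 = cmod (b (u - w) (u - v))"
    using self_eq[OF mem(4)] by (metis norm_of_real abs_power2)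
  also have "\<dots> \<le> energy_norm b (u - w) * energy_norm b (u - v)"
    by (rule Cauchy_Schwarz) (use mem in auto)
  finally have "energy_norm b (u - w) * energy_norm b (u - w)
      \<le> energy_norm b (u - w) * energy_norm b (u - v)"
    by (simp add: power2_eq_square)
  then show ?thesis
    using energy_norm_nonneg[OF mem(4)] energy_norm_nonneg[OF mem(5)]
    by (cases "energy_norm b (u - w) = 0") auto
qed

end

lemma hermitian_form_mono:
  assumes "hermitian_form X b" "smult_subspace V" "V \<subseteq> X"
  shows "hermitian_form V b"
proof -
  interpret X: hermitian_form X b by fact
  show ?thesis
    using assms(3) by unfold_locales
      (auto intro: assms(2) X.add_left X.smult_left X.hermitian X.nonneg)
qed

section \<open>Coercive forms and Riesz bases\<close>

definition combination :: "('k \<Rightarrow> 'n::finite h1) \<Rightarrow> 'k set \<Rightarrow> ('k \<Rightarrow> complex) \<Rightarrow> 'n h1" where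
  "combination \<psi> F x = (\<Sum>k\<in>F. smult (x k) (\<psi> k))"

text \<open>The weights \<open>d\<close> are absorbed into the basis: \<open>\<psi> k\<close> stands for \<open>\<phi> k / sqrt (d k)\<close>. The form
  \<open>h\<close> is the inner product of \<open>V\<close>.\<close>

locale coercive_riesz =
  a: hermitian_form V a + h: hermitian_form V h
  for V :: "'n::finite h1 set" and a h :: "'n h1 \<Rightarrow> 'n h1 \<Rightarrow> complex" +
  fixes K :: "'k set" and \<psi> :: "'k \<Rightarrow> 'n h1" and \<alpha>\<^sub>l \<alpha>\<^sub>u \<beta>\<^sub>l \<beta>\<^sub>u :: real
  assumes constants: "0 < \<alpha>\<^sub>l" "0 < \<alpha>\<^sub>u" "0 < \<beta>\<^sub>l" "0 < \<beta>\<^sub>u"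
    and lower: "v \<in> V \<Longrightarrow> sqrt \<alpha>\<^sub>l * energy_norm h v \<le> energy_norm a v"
    and upper: "v \<in> V \<Longrightarrow> energy_norm a v \<le> sqrt \<alpha>\<^sub>u * energy_norm h v"
    and basis: "k \<in> K \<Longrightarrow> \<psi> k \<in> V"
    and expansion: "v \<in> V \<Longrightarrow>
      \<exists>x. ((\<lambda>F. energy_norm h (v - combination \<psi> F x)) \<longlongrightarrow> 0) (finite_subsets_at_top K)"
    and riesz: "v \<in> V \<Longrightarrow>
      ((\<lambda>F. energy_norm h (v - combination \<psi> F x)) \<longlongrightarrow> 0) (finite_subsets_at_top K) \<Longrightarrow>
      (\<lambda>k. (cmod (x k))\<^sup>2) summable_on K \<and>
      \<beta>\<^sub>l * energy_norm h v \<le> l2_norm K x \<and> l2_norm K x \<le> \<beta>\<^sub>u * energy_norm h v"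
begin

lemma combination_mem: "F \<subseteq> K \<Longrightarrow> combination \<psi> F x \<in> V"
  unfolding combination_def using basis by (intro a.closed(6) a.closed(3)) auto

lemma form_combination_left:
  assumes "F \<subseteq> K" "w \<in> V"
  shows "a (combination \<psi> F x) w = (\<Sum>k\<in>F. x k * a (\<psi> k) w)"
  unfolding combination_def using assms basis a.closed(3)
  by (subst a.sum_left) (auto simp: subset_eq intro!: sum.cong a.smult_left)

lemma form_combination_right:
  assumes "F \<subseteq> K" "w \<in> V"
  shows "a w (combination \<psi> F x) = (\<Sum>k\<in>F. cnj (x k) * a w (\<psi> k))"
  unfolding combination_def using assms basis a.closed(3)
  by (subst a.sum_right) (auto simp: subset_eq intro!: sum.cong a.smult_right)

text \<open>A finite combination is its own expansion: with coefficients extended by 0 the partial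
  sums are eventually constant. The lower Riesz inequality therefore applies to it.\<close>

lemma energy_norm_combination_le:
  assumes "finite F" "F \<subseteq> K"
  shows "energy_norm a (combination \<psi> F x) \<le> sqrt \<alpha>\<^sub>u / \<beta>\<^sub>l * l2_norm F x"
proof -
  let ?x = "\<lambda>k. if k \<in> F then x k else 0"
  have eq: "combination \<psi> G ?x = combination \<psi> F x" if "finite G" "F \<subseteq> G" for G
    unfolding combination_def
    by (rule sum.mono_neutral_cong_right) (use that in \<open>auto simp: smult_zero\<close>)
  have "\<forall>\<^sub>F G in finite_subsets_at_top K.
      energy_norm h (combination \<psi> F x - combination \<psi> G ?x) = 0"
    unfolding eventually_finite_subsets_at_top
    using assms eq by (intro exI[of _ F]) (auto simp: h.energy_norm_zero)
  then have "((\<lambda>G. energy_norm h (combination \<psi> F x - combination \<psi> G ?x)) \<longlongrightarrow> 0)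
      (finite_subsets_at_top K)"
    by (rule tendsto_eventually)
  from riesz[OF combination_mem[OF assms(2)] this]
  have "\<beta>\<^sub>l * energy_norm h (combination \<psi> F x) \<le> l2_norm F x"
    using l2_norm_restrict[OF assms(2)] by simp
  then have "sqrt \<alpha>\<^sub>u * energy_norm h (combination \<psi> F x) \<le> sqrt \<alpha>\<^sub>u * (l2_norm F x / \<beta>\<^sub>l)"
    using constants by (intro mult_left_mono) (auto simp: field_simps)
  then show ?thesis
    using upper[OF combination_mem[OF assms(2)], of x] by simp
qed

lemma form_tendsto:
  assumes "v \<in> V" "w \<in> V"
    and "((\<lambda>F. energy_norm h (v - combination \<psi> F x)) \<longlongrightarrow> 0) (finite_subsets_at_top K)"
  shows "((\<lambda>F. a (combination \<psi> F x) w) \<longlongrightarrow> a v w) (finite_subsets_at_top K)"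
proof (rule LIM_zero_cancel, rule Lim_null_comparison)
  show "((\<lambda>F. sqrt \<alpha>\<^sub>u * energy_norm h (v - combination \<psi> F x) * energy_norm a w) \<longlongrightarrow> 0)
      (finite_subsets_at_top K)"
    using tendsto_mult_left_zero[OF tendsto_mult_right_zero[OF assms(3)]] .
  show "\<forall>\<^sub>F F in finite_subsets_at_top K. norm (a (combination \<psi> F x) w - a v w)
      \<le> sqrt \<alpha>\<^sub>u * energy_norm h (v - combination \<psi> F x) * energy_norm a w"
  proof (rule eventually_finite_subsets_at_top_weakI)
    fix F assume "finite F" "F \<subseteq> K"
    then have mem: "combination \<psi> F x \<in> V" "v - combination \<psi> F x \<in> V"
      using combination_mem assms(1) a.closed(5) by auto
    have "norm (a (combination \<psi> F x) w - a v w) = norm (a (v - combination \<psi> F x) w)"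
      using mem assms by (simp add: a.diff_left norm_minus_commute)
    also have "\<dots> \<le> energy_norm a (v - combination \<psi> F x) * energy_norm a w"
      using mem assms by (intro a.Cauchy_Schwarz)
    also have "\<dots> \<le> sqrt \<alpha>\<^sub>u * energy_norm h (v - combination \<psi> F x) * energy_norm a w"
      using mem assms upper a.energy_norm_nonneg by (intro mult_right_mono) auto
    finally show "norm (a (combination \<psi> F x) w - a v w)
      \<le> sqrt \<alpha>\<^sub>u * energy_norm h (v - combination \<psi> F x) * energy_norm a w" .
  qed
qed

text \<open>The difference of the two sequences expands 0, and the upper Riesz inequality then
  forces its norm to vanish.\<close>

lemma coefficients_unique:
  assumes v: "v \<in> V"
    and x: "((\<lambda>F. energy_norm h (v - combination \<psi> F x)) \<longlongrightarrow> 0) (finite_subsets_at_top K)"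
    and y: "((\<lambda>F. energy_norm h (v - combination \<psi> F y)) \<longlongrightarrow> 0) (finite_subsets_at_top K)"
    and "k \<in> K"
  shows "x k = y k"
proof -
  have "((\<lambda>F. energy_norm h (0 - combination \<psi> F (\<lambda>k. x k - y k))) \<longlongrightarrow> 0) (finite_subsets_at_top K)"
  proof (rule Lim_null_comparison[OF _ tendsto_add_zero[OF y x]], rule eventually_finite_subsets_at_top_weakI)
    fix F assume F: "finite F" "F \<subseteq> K"
    have "0 - combination \<psi> F (\<lambda>k. x k - y k) = (v - combination \<psi> F x) - (v - combination \<psi> F y)"
      by (simp add: combination_def smult_diff_left sum_subtractf)
    moreover have m: "v - combination \<psi> F x \<in> V" "v - combination \<psi> F y \<in> V"
      using combination_mem[OF F(2)] v a.closed(5) by auto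
    ultimately show "norm (energy_norm h (0 - combination \<psi> F (\<lambda>k. x k - y k)))
        \<le> energy_norm h (v - combination \<psi> F y) + energy_norm h (v - combination \<psi> F x)"
      using h.energy_norm_diff_triangle[OF m] h.energy_norm_nonneg[OF a.closed(5)[OF m]] by simp
  qed
  from riesz[OF a.closed(1) this]
  have "(\<lambda>k. (cmod (x k - y k))\<^sup>2) summable_on K" "l2_norm K (\<lambda>k. x k - y k) \<le> 0"
    by (auto simp: h.energy_norm_zero)
  from l2_norm_eq_0[OF this \<open>k \<in> K\<close>] show ?thesis by simp
qed

text \<open>Testing with the element whose coefficients are those of the functional turns a bound of the
  functional into a bound of its coefficients.\<close>

lemma residual_l2_norm:
  assumes "e \<in> V"
  shows "(\<lambda>k. (cmod (a e (\<psi> k)))\<^sup>2) summable_on K"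
    and "l2_norm K (\<lambda>k. a e (\<psi> k)) \<le> sqrt \<alpha>\<^sub>u / \<beta>\<^sub>l * energy_norm a e"
proof -
  have *: "L2_set (\<lambda>k. cmod (a e (\<psi> k))) F \<le> sqrt \<alpha>\<^sub>u / \<beta>\<^sub>l * energy_norm a e"
    if F: "finite F" "F \<subseteq> K" for F
  proof -
    let ?g = "\<lambda>k. a e (\<psi> k)"
    let ?s = "L2_set (\<lambda>k. cmod (?g k)) F"
    have l2F: "l2_norm F ?g = ?s"
      using F by (simp add: l2_norm_def L2_set_def)
    have "?s\<^sup>2 = cmod (a e (combination \<psi> F ?g))"
    proof -
      have "a e (combination \<psi> F ?g) = of_real (\<Sum>k\<in>F. (cmod (?g k))\<^sup>2)"
        unfolding form_combination_right[OF F(2) assms] of_real_sum complex_norm_square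
        by (simp add: mult.commute)
      then show ?thesis
        by (simp only: norm_of_real) (simp add: L2_set_def sum_nonneg)
    qed
    also have "\<dots> \<le> energy_norm a e * energy_norm a (combination \<psi> F ?g)"
      using assms combination_mem F by (intro a.Cauchy_Schwarz)
    also have "\<dots> \<le> energy_norm a e * (sqrt \<alpha>\<^sub>u / \<beta>\<^sub>l * ?s)"
      using energy_norm_combination_le[OF F, of ?g] l2F a.energy_norm_nonneg[OF assms]
      by (intro mult_left_mono) auto
    finally have "?s\<^sup>2 \<le> (sqrt \<alpha>\<^sub>u / \<beta>\<^sub>l * energy_norm a e) * ?s"
      by (simp add: mult_ac)
    then show ?thesis
      by (rule le_if_square_le_mult) (use constants a.energy_norm_nonneg[OF assms] in simp)
  qed
  show "(\<lambda>k. (cmod (a e (\<psi> k)))\<^sup>2) summable_on K"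
    by (rule l2_norm_bounded_partial_sums(1)[OF *])
  show "l2_norm K (\<lambda>k. a e (\<psi> k)) \<le> sqrt \<alpha>\<^sub>u / \<beta>\<^sub>l * energy_norm a e"
    by (rule l2_norm_bounded_partial_sums(2)[OF *])
qed

text \<open>Expanding one argument of \<open>a e e\<close> pairs the coefficients of
  \<open>e\<close> with those of the residual. Cauchy-Schwarz for sequences, the upper Riesz
  inequality and coercivity leave one factor \<open>energy_norm a e\<close> to cancel. The pairing
  is estimated on finite sections, since the expansion is only a limit.\<close>

lemma energy_norm_le_residual:
  assumes "e \<in> V"
  shows "energy_norm a e \<le> \<beta>\<^sub>u / sqrt \<alpha>\<^sub>l * l2_norm K (\<lambda>k. a e (\<psi> k))"
proof -
  let ?g = "\<lambda>k. a e (\<psi> k)"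
  obtain x where x: "((\<lambda>F. energy_norm h (e - combination \<psi> F x)) \<longlongrightarrow> 0) (finite_subsets_at_top K)"
    using expansion[OF assms] by blast
  note r = riesz[OF assms x]
  have "cmod (a e e) \<le> l2_norm K x * l2_norm K ?g"
  proof (rule tendsto_upperbound)
    show "((\<lambda>F. cmod (a (combination \<psi> F x) e)) \<longlongrightarrow> cmod (a e e)) (finite_subsets_at_top K)"
      by (intro tendsto_norm form_tendsto assms x)
    show "\<forall>\<^sub>F F in finite_subsets_at_top K. cmod (a (combination \<psi> F x) e) \<le> l2_norm K x * l2_norm K ?g"
    proof (rule eventually_finite_subsets_at_top_weakI)
      fix F assume F: "finite F" "F \<subseteq> K"
      have "a (\<psi> k) e = cnj (?g k)" if "k \<in> F" for k
        using that F basis assms by (intro a.hermitian) auto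
      then have "cmod (a (combination \<psi> F x) e) = cmod (\<Sum>k\<in>F. x k * cnj (?g k))"
        using F assms by (simp add: form_combination_left)
      also have "\<dots> \<le> (\<Sum>k\<in>F. \<bar>cmod (x k)\<bar> * \<bar>cmod (?g k)\<bar>)"
        by (rule order_trans[OF norm_sum]) (simp add: norm_mult)
      also have "\<dots> \<le> L2_set (\<lambda>k. cmod (x k)) F * L2_set (\<lambda>k. cmod (?g k)) F"
        by (rule L2_set_mult_ineq)
      also have "\<dots> \<le> l2_norm K x * l2_norm K ?g"
        using r residual_l2_norm(1)[OF assms] F
        by (intro mult_mono L2_set_le_l2_norm l2_norm_nonneg) auto
      finally show "cmod (a (combination \<psi> F x) e) \<le> l2_norm K x * l2_norm K ?g" .
    qed
  qed simp
  also have "\<dots> \<le> (\<beta>\<^sub>u * energy_norm h e) * l2_norm K ?g"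
    using r by (intro mult_right_mono l2_norm_nonneg) auto
  also have "\<dots> \<le> (\<beta>\<^sub>u * (energy_norm a e / sqrt \<alpha>\<^sub>l)) * l2_norm K ?g"
    using lower[OF assms] constants
    by (intro mult_right_mono mult_left_mono l2_norm_nonneg) (auto simp: field_simps)
  finally have "(energy_norm a e)\<^sup>2 \<le> (\<beta>\<^sub>u / sqrt \<alpha>\<^sub>l * l2_norm K ?g) * energy_norm a e"
    using a.self_eq[OF assms] by (simp add: norm_mult power2_eq_square mult_ac)
  then show ?thesis
    by (rule le_if_square_le_mult) (use constants l2_norm_nonneg[of K ?g] in simp)
qed

text \<open>The exact correction with residual \<open>b\<close> restricted to \<open>M\<close> has the coefficients
  \<open>N b\<close>. No element of \<open>V\<close> with these coefficients is constructed (that would need completeness):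
  its finite sections suffice, as only their limit enters the estimate.\<close>

lemma truncated_correction:
  assumes e: "e \<in> V" and M: "finite M" "M \<subseteq> K" and E: "finite E" "E \<subseteq> K"
    and inv: "l2_inverse K (\<lambda>l k. a (\<psi> k) (\<psi> l)) N"
    and trunc: "l2_bounded K (\<lambda>l k. N l k - T l k)" "l2_opnorm K (\<lambda>l k. N l k - T l k) \<le> \<tau>"
    and supp: "\<And>l k. l \<in> K - E \<Longrightarrow> k \<in> M \<Longrightarrow> T l k = 0"
  shows "\<exists>y. energy_norm a (e - combination \<psi> E y)
    \<le> \<beta>\<^sub>u / sqrt \<alpha>\<^sub>l * l2_norm (K - M) (\<lambda>k. a e (\<psi> k)) + sqrt \<alpha>\<^sub>u / \<beta>\<^sub>l * (\<tau> * l2_norm M (\<lambda>k. a e (\<psi> k)))"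
proof -
  define A where "A = (\<lambda>l k. a (\<psi> k) (\<psi> l))"
  define b where "b = (\<lambda>k. a e (\<psi> k))"
  define bM where "bM = (\<lambda>k. if k \<in> M then b k else 0)"
  define x where "x = mat_apply K N bM"
  define y where "y = mat_apply K T bM"
  have b: "(\<lambda>k. (cmod (b k))\<^sup>2) summable_on K"
    unfolding b_def by (rule residual_l2_norm(1)[OF e])
  have bM: "bM \<in> l2 K" "l2_norm K bM = l2_norm M b"
    unfolding bM_def using l2_restrict[OF b M(2)] l2_norm_restrict[OF M(2)] by auto
  have x: "x \<in> l2 K" and Ax: "mat_apply K A x = bM"
    using inv bM by (auto simp: x_def A_def l2_inverse_def l2_bounded_def)
  have Abd: "l2_bounded K A"
    using inv by (simp add: l2_inverse_def A_def)
  have xs: "(\<lambda>k. (cmod (x k))\<^sup>2) summable_on K"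
    using x by (simp add: l2_def)
  \<comment> \<open>As \<open>bM\<close> has finite support, each row is a finite sum for any
    matrix; this covers \<open>T\<close>, for which only the difference from \<open>N\<close> is
    known to be bounded.\<close>
  have fin: "mat_apply K N' bM l = (\<Sum>k\<in>M. N' l k * b k)" if "l \<in> K" for N' l
    using mat_apply_finite[OF M, of bM l N'] that by (simp add: bM_def)
  have y0: "y l = 0" if "l \<in> K - E" for l
    using that supp by (simp add: y_def fin)
  have D: "mat_apply K (\<lambda>l k. N l k - T l k) bM l = x l - y l" if "l \<in> K" for l
    using that by (simp add: x_def y_def fin left_diff_distrib sum_subtractf)
  have xy: "l2_norm K (\<lambda>k. x k - y k) \<le> \<tau> * l2_norm M b"
  proof -
    have "l2_norm K (\<lambda>k. x k - y k) = l2_norm K (mat_apply K (\<lambda>l k. N l k - T l k) bM)"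
      by (rule l2_norm_cong) (simp add: D)
    also have "\<dots> \<le> l2_opnorm K (\<lambda>l k. N l k - T l k) * l2_norm M b"
      using l2_norm_mat_apply_le[OF trunc(1) bM(1)] bM(2) by simp
    also have "\<dots> \<le> \<tau> * l2_norm M b"
      by (intro mult_right_mono trunc l2_norm_nonneg)
    finally show ?thesis .
  qed
  have xys: "(\<lambda>k. (cmod (x k - y k))\<^sup>2) summable_on K"
  proof -
    have "mat_apply K (\<lambda>l k. N l k - T l k) bM \<in> l2 K"
      using trunc(1) bM by (simp add: l2_bounded_def)
    then have "(\<lambda>k. (cmod (mat_apply K (\<lambda>l k. N l k - T l k) bM k))\<^sup>2) summable_on K"
      by (simp add: l2_def)
    then show ?thesis
      by (rule summable_on_cong[THEN iffD1, rotated]) (simp add: D)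
  qed
  define c1 where "c1 = \<beta>\<^sub>u / sqrt \<alpha>\<^sub>l"
  define c2 where "c2 = sqrt \<alpha>\<^sub>u / \<beta>\<^sub>l"
  have c: "0 \<le> c1" "0 \<le> c2"
    using constants by (auto simp: c1_def c2_def)
  \<comment> \<open>The section \<open>F\<close> of the exact coefficients \<open>x\<close> gives an
    intermediate element \<open>?z\<close>. The error splits into \<open>e - ?z\<close>, controlled
    through its residual, and \<open>?z - ?w\<close>, controlled through its coefficients.\<close>
  have est: "energy_norm a (e - combination \<psi> E y)
      \<le> c1 * (l2_norm (K - M) b + l2_opnorm K A * l2_norm (K - F) x) + c2 * (\<tau> * l2_norm M b)"
    if F: "finite F" "F \<subseteq> K" "E \<subseteq> F" for F
  proof -
    let ?z = "combination \<psi> F x" and ?w = "combination \<psi> E y"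
    define t where "t = (\<lambda>k. if k \<in> K - F then x k else 0)"
    have t: "t \<in> l2 K" "l2_norm K t = l2_norm (K - F) x"
      unfolding t_def using l2_restrict[OF xs, of "K - F"] l2_norm_restrict[of "K - F" K] by auto
    have mem: "?z \<in> V" "?w \<in> V" "e - ?z \<in> V" "?z - ?w \<in> V"
      using F E e combination_mem a.closed(5) by auto
    \<comment> \<open>Since \<open>A\<close> maps \<open>x\<close> to \<open>bM\<close>, the section
      \<open>?z\<close> reproduces \<open>bM\<close> up to the image of the tail \<open>t\<close>.
      What remains of \<open>b\<close> is its unmarked part plus
      \<open>mat_apply K A t\<close>.\<close>
    have res: "a (e - ?z) (\<psi> l) = (if l \<in> K - M then b l else 0) + mat_apply K A t l"
      if l: "l \<in> K" for l
    proof -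
      let ?xF = "\<lambda>k. if k \<in> F then x k else 0"
      have "t = (\<lambda>k. x k - ?xF k)"
        using x by (auto simp: t_def l2_def fun_eq_iff)
      then have "mat_apply K A t l = mat_apply K A x l - mat_apply K A ?xF l"
        using mat_apply_diff[OF Abd x _ l] l2_restrict[OF xs F(2)] by simp
      also have "mat_apply K A ?xF l = (\<Sum>k\<in>F. A l k * x k)"
        using mat_apply_finite[OF F(1,2) _ l, of ?xF A] by simp
      also have "\<dots> = a ?z (\<psi> l)"
        using F l basis by (simp add: form_combination_left A_def mult.commute)
      finally show ?thesis
        using mem e l basis by (simp add: Ax a.diff_left bM_def b_def)
    qed
    have "l2_norm K (\<lambda>l. a (e - ?z) (\<psi> l))
        = l2_norm K (\<lambda>l. (if l \<in> K - M then b l else 0) + mat_apply K A t l)"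
      by (rule l2_norm_cong) (simp add: res)
    also have "\<dots> \<le> l2_norm K (\<lambda>l. if l \<in> K - M then b l else 0) + l2_norm K (mat_apply K A t)"
      using l2_restrict[OF b, of "K - M"] Abd t
      by (intro l2_norm_add) (auto simp: l2_def l2_bounded_def)
    also have "\<dots> \<le> l2_norm (K - M) b + l2_opnorm K A * l2_norm (K - F) x"
      using l2_norm_mat_apply_le[OF Abd t(1)] t(2) l2_norm_restrict[of "K - M" K b] by auto
    finally have 1: "energy_norm a (e - ?z)
        \<le> c1 * (l2_norm (K - M) b + l2_opnorm K A * l2_norm (K - F) x)"
      using energy_norm_le_residual[OF mem(3)] mult_left_mono[OF _ c(1)] unfolding c1_def
      by (meson order_trans)
    \<comment> \<open>The coefficients \<open>y\<close> vanish off \<open>E\<close>, so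
      \<open>?w\<close> may be written over the larger \<open>F\<close> and compared with
      \<open>?z\<close> termwise.\<close>
    have "?w = combination \<psi> F y"
      unfolding combination_def
      by (rule sum.mono_neutral_left) (use F y0 in \<open>auto simp: smult_zero subset_eq\<close>)
    then have "?z - ?w = combination \<psi> F (\<lambda>k. x k - y k)"
      by (simp add: combination_def smult_diff_left sum_subtractf)
    then have "energy_norm a (?z - ?w) \<le> c2 * l2_norm F (\<lambda>k. x k - y k)"
      using energy_norm_combination_le[OF F(1,2)] by (simp add: c2_def)
    also have "\<dots> \<le> c2 * (\<tau> * l2_norm M b)"
      by (intro mult_left_mono c order_trans[OF l2_norm_mono_set[OF xys F(2)] xy])
    finally have 2: "energy_norm a (?z - ?w) \<le> c2 * (\<tau> * l2_norm M b)" .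
    show ?thesis
      using a.energy_norm_triangle[OF mem(3,4)] 1 2 by simp
  qed
  \<comment> \<open>The left side does not depend on \<open>F\<close>; letting \<open>F\<close> grow
    removes the tail term from the bound.\<close>
  have "energy_norm a (e - combination \<psi> E y)
      \<le> c1 * (l2_norm (K - M) b + l2_opnorm K A * 0) + c2 * (\<tau> * l2_norm M b)"
  proof (rule tendsto_lowerbound)
    show "((\<lambda>F. c1 * (l2_norm (K - M) b + l2_opnorm K A * l2_norm (K - F) x) + c2 * (\<tau> * l2_norm M b))
        \<longlongrightarrow> c1 * (l2_norm (K - M) b + l2_opnorm K A * 0) + c2 * (\<tau> * l2_norm M b))
        (finite_subsets_at_top K)"
      by (intro tendsto_intros l2_norm_tail xs)
    show "\<forall>\<^sub>F F in finite_subsets_at_top K. energy_norm a (e - combination \<psi> E y)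
      \<le> c1 * (l2_norm (K - M) b + l2_opnorm K A * l2_norm (K - F) x) + c2 * (\<tau> * l2_norm M b)"
      unfolding eventually_finite_subsets_at_top using E est by blast
  qed simp
  then show ?thesis
    unfolding b_def c1_def c2_def by auto
qed

end

section \<open>The space of pairs with square-integrable components\<close>

text \<open>The ambient space for the forms imposes no weak-derivative identity. Differences
  \<open>w - (\<psi>, grad \<psi>)\<close> thus belong to it without a proof that classical
  gradients are weak ones.\<close>

definition L2_pairs :: "(real^'n::finite) set \<Rightarrow> 'n h1 set" where
  "L2_pairs \<Omega> = {w. square_integrable \<Omega> (fst w) \<and> square_integrable \<Omega> (snd w)}"

lemma square_integrable_add:
  assumes "square_integrable \<Omega> u" "square_integrable \<Omega> v"
  shows "square_integrable \<Omega> (\<lambda>x. u x + v x)"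
proof -
  have [measurable]: "u \<in> borel_measurable (lebesgue_on \<Omega>)" "v \<in> borel_measurable (lebesgue_on \<Omega>)"
    and int: "integrable (lebesgue_on \<Omega>) (\<lambda>x. 2 * (norm (u x))\<^sup>2 + 2 * (norm (v x))\<^sup>2)"
    using assms by (auto simp: square_integrable_def)
  have "(norm (u x + v x))\<^sup>2 \<le> 2 * (norm (u x))\<^sup>2 + 2 * (norm (v x))\<^sup>2" for x
  proof -
    have "(norm (u x + v x))\<^sup>2 \<le> (norm (u x) + norm (v x))\<^sup>2"
      by (intro power_mono norm_triangle_ineq) simp
    also have "\<dots> \<le> 2 * (norm (u x))\<^sup>2 + 2 * (norm (v x))\<^sup>2"
      using zero_le_power2[of "norm (u x) - norm (v x)"] by (simp add: power2_eq_square algebra_simps)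
    finally show ?thesis .
  qed
  then have "integrable (lebesgue_on \<Omega>) (\<lambda>x. (norm (u x + v x))\<^sup>2)"
    by (intro Bochner_Integration.integrable_bound[OF int] AE_I2) auto
  then show ?thesis
    by (simp add: square_integrable_def)
qed

lemma square_integrable_component:
  fixes G :: "real^'n::finite \<Rightarrow> complex^'n"
  assumes "square_integrable \<Omega> G"
  shows "square_integrable \<Omega> (\<lambda>x. G x $ i)"
proof -
  have G: "G \<in> borel_measurable (lebesgue_on \<Omega>)"
    and int: "integrable (lebesgue_on \<Omega>) (\<lambda>x. (norm (G x))\<^sup>2)"
    using assms by (auto simp: square_integrable_def)
  have [measurable]: "(\<lambda>x. G x $ i) \<in> borel_measurable (lebesgue_on \<Omega>)"
    by (rule borel_measurable_continuous_on[OF _ G]) (intro continuous_intros)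
  have "integrable (lebesgue_on \<Omega>) (\<lambda>x. (norm (G x $ i))\<^sup>2)"
    by (intro Bochner_Integration.integrable_bound[OF int] AE_I2)
       (auto intro!: power_mono Finite_Cartesian_Product.norm_nth_le)
  then show ?thesis
    by (simp add: square_integrable_def)
qed

lemma square_integrable_smult_vec:
  fixes G :: "real^'n::finite \<Rightarrow> complex^'n"
  assumes "square_integrable \<Omega> G"
  shows "square_integrable \<Omega> (\<lambda>x. c *s G x)"
proof -
  have G: "G \<in> borel_measurable (lebesgue_on \<Omega>)"
    and int: "integrable (lebesgue_on \<Omega>) (\<lambda>x. (cmod c)\<^sup>2 * (norm (G x))\<^sup>2)"
    using assms by (auto simp: square_integrable_def)
  have "(\<lambda>x. c *s G x) \<in> borel_measurable (lebesgue_on \<Omega>)"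
    unfolding vector_scalar_mult_def
    by (rule borel_measurable_continuous_on[OF _ G]) (intro continuous_intros)
  moreover have "norm (c *s G x) = cmod c * norm (G x)" for x
    by (simp add: norm_vec_def norm_mult L2_set_right_distrib)
  ultimately show ?thesis
    using int by (simp add: square_integrable_def power_mult_distrib)
qed

lemma square_integrable_cmult:
  fixes u :: "real^'n::finite \<Rightarrow> complex"
  assumes "square_integrable \<Omega> u"
  shows "square_integrable \<Omega> (\<lambda>x. c * u x)"
  using assms by (auto simp: square_integrable_def norm_mult power_mult_distrib)

text \<open>The product is dominated by \<open>B\<close> times the sum of the two squares.\<close>

lemma integrable_weighted_product:
  fixes u v :: "real^'n::finite \<Rightarrow> complex"
  assumes "square_integrable \<Omega> u" "square_integrable \<Omega> v"
    and "m \<in> borel_measurable (lebesgue_on \<Omega>)" "\<And>x. x \<in> \<Omega> \<Longrightarrow> \<bar>m x\<bar> \<le> B"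
  shows "integrable (lebesgue_on \<Omega>) (\<lambda>x. of_real (m x) * u x * cnj (v x))"
proof -
  have u[measurable]: "u \<in> borel_measurable (lebesgue_on \<Omega>)"
    and v: "v \<in> borel_measurable (lebesgue_on \<Omega>)"
    and int: "integrable (lebesgue_on \<Omega>) (\<lambda>x. B * ((norm (u x))\<^sup>2 + (norm (v x))\<^sup>2))"
    using assms by (auto simp: square_integrable_def)
  note [measurable] = assms(3)
  have [measurable]: "(\<lambda>x. cnj (v x)) \<in> borel_measurable (lebesgue_on \<Omega>)"
    by (rule borel_measurable_continuous_on[OF _ v]) (intro continuous_intros)
  show ?thesis
  proof (rule Bochner_Integration.integrable_bound[OF int])
    show "AE x in lebesgue_on \<Omega>. norm (of_real (m x) * u x * cnj (v x))
        \<le> norm (B * ((norm (u x))\<^sup>2 + (norm (v x))\<^sup>2))"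
    proof (rule AE_I2)
      fix x assume "x \<in> space (lebesgue_on \<Omega>)"
      then have m: "\<bar>m x\<bar> \<le> B" using assms(4) by simp
      have "norm (u x) * norm (v x) \<le> (norm (u x))\<^sup>2 + (norm (v x))\<^sup>2"
        using zero_le_power2[of "norm (u x) - norm (v x)"] mult_nonneg_nonneg[of "norm (u x)" "norm (v x)"]
        using norm_ge_zero[of "u x"] norm_ge_zero[of "v x"] unfolding power2_diff by linarith
      then have "\<bar>m x\<bar> * (norm (u x) * norm (v x)) \<le> B * ((norm (u x))\<^sup>2 + (norm (v x))\<^sup>2)"
        using m by (intro mult_mono) auto
      then show "norm (of_real (m x) * u x * cnj (v x))
          \<le> norm (B * ((norm (u x))\<^sup>2 + (norm (v x))\<^sup>2))"
        by (simp add: norm_mult mult.assoc)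
    qed
  qed measurable
qed

lemma L2_pairs_subspace: "smult_subspace (L2_pairs \<Omega>)"
  unfolding smult_subspace_def L2_pairs_def
  by (auto simp: smult_def plus_fun_def square_integrable_add square_integrable_cmult
      square_integrable_smult_vec)
     (auto simp: square_integrable_def zero_fun_def)

lemma sum_mult_cnj_vec: "(\<Sum>i\<in>UNIV. z $ i * cnj (z $ i)) = of_real ((norm (z :: complex^'n::finite))\<^sup>2)"
  unfolding norm_vec_def L2_set_def
  by (simp add: sum_nonneg complex_norm_square[symmetric] del: of_real_power)

locale coefficients =
  fixes \<Omega> :: "(real^'n::finite) set" and \<nu> \<sigma> :: "real^'n \<Rightarrow> real" and \<nu>\<^sub>l \<nu>\<^sub>u \<sigma>\<^sub>l \<sigma>\<^sub>u :: real
  assumes \<nu>: "\<nu> \<in> borel_measurable (lebesgue_on \<Omega>)" "0 < \<nu>\<^sub>l" "\<And>x. x \<in> \<Omega> \<Longrightarrow> \<nu>\<^sub>l \<le> \<nu> x \<and> \<nu> x \<le> \<nu>\<^sub>u"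
    and \<sigma>: "\<sigma> \<in> borel_measurable (lebesgue_on \<Omega>)" "0 < \<sigma>\<^sub>l" "\<And>x. x \<in> \<Omega> \<Longrightarrow> \<sigma>\<^sub>l \<le> \<sigma> x \<and> \<sigma> x \<le> \<sigma>\<^sub>u"
begin

lemma weighted_integrable:
  assumes "square_integrable \<Omega> u" "square_integrable \<Omega> v"
  shows "integrable (lebesgue_on \<Omega>) (\<lambda>x. of_real (\<nu> x) * u x * cnj (v x))"
    and "integrable (lebesgue_on \<Omega>) (\<lambda>x. of_real (\<sigma> x) * u x * cnj (v x))"
proof -
  have b: "\<bar>\<nu> x\<bar> \<le> \<nu>\<^sub>u" "\<bar>\<sigma> x\<bar> \<le> \<sigma>\<^sub>u" if "x \<in> \<Omega>" for x
    using \<nu>(2) \<nu>(3)[OF that] \<sigma>(2) \<sigma>(3)[OF that] by linarith+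
  show "integrable (lebesgue_on \<Omega>) (\<lambda>x. of_real (\<nu> x) * u x * cnj (v x))"
    by (rule integrable_weighted_product[OF assms \<nu>(1) b(1)])
  show "integrable (lebesgue_on \<Omega>) (\<lambda>x. of_real (\<sigma> x) * u x * cnj (v x))"
    by (rule integrable_weighted_product[OF assms \<sigma>(1) b(2)])
qed

lemma energy_form_integrable:
  assumes "u \<in> L2_pairs \<Omega>" "v \<in> L2_pairs \<Omega>"
  shows "integrable (lebesgue_on \<Omega>) (\<lambda>x. of_real (\<nu> x) * (\<Sum>i\<in>UNIV. snd u x $ i * cnj (snd v x $ i)))"
    and "integrable (lebesgue_on \<Omega>) (\<lambda>x. of_real (\<sigma> x) * fst u x * cnj (fst v x))"
proof -
  have "integrable (lebesgue_on \<Omega>) (\<lambda>x. \<Sum>i\<in>UNIV. of_real (\<nu> x) * snd u x $ i * cnj (snd v x $ i))"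
    using assms unfolding L2_pairs_def
    by (intro Bochner_Integration.integrable_sum weighted_integrable square_integrable_component) auto
  then show "integrable (lebesgue_on \<Omega>)
      (\<lambda>x. of_real (\<nu> x) * (\<Sum>i\<in>UNIV. snd u x $ i * cnj (snd v x $ i)))"
    by (simp add: sum_distrib_left mult.assoc)
qed (use assms in \<open>auto simp: L2_pairs_def intro: weighted_integrable\<close>)

lemma energy_form_self:
  assumes "v \<in> L2_pairs \<Omega>"
  shows "integrable (lebesgue_on \<Omega>) (\<lambda>x. \<nu> x * (norm (snd v x))\<^sup>2)"
    and "integrable (lebesgue_on \<Omega>) (\<lambda>x. \<sigma> x * (norm (fst v x))\<^sup>2)"
    and "energy_form \<Omega> \<nu> \<sigma> v v = of_real ((LINT x|lebesgue_on \<Omega>. \<nu> x * (norm (snd v x))\<^sup>2)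
      + (LINT x|lebesgue_on \<Omega>. \<sigma> x * (norm (fst v x))\<^sup>2))"
proof -
  have eq: "of_real (\<nu> x) * (\<Sum>i\<in>UNIV. snd v x $ i * cnj (snd v x $ i))
      = complex_of_real (\<nu> x * (norm (snd v x))\<^sup>2)"
    "of_real (\<sigma> x) * fst v x * cnj (fst v x) = complex_of_real (\<sigma> x * (norm (fst v x))\<^sup>2)" for x
    using complex_norm_square[of "fst v x"] by (simp_all add: sum_mult_cnj_vec mult.assoc)
  show "integrable (lebesgue_on \<Omega>) (\<lambda>x. \<nu> x * (norm (snd v x))\<^sup>2)"
    and "integrable (lebesgue_on \<Omega>) (\<lambda>x. \<sigma> x * (norm (fst v x))\<^sup>2)"
    using energy_form_integrable[OF assms assms] unfolding eq complex_of_real_integrable_eq by auto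
  show "energy_form \<Omega> \<nu> \<sigma> v v = of_real ((LINT x|lebesgue_on \<Omega>. \<nu> x * (norm (snd v x))\<^sup>2)
      + (LINT x|lebesgue_on \<Omega>. \<sigma> x * (norm (fst v x))\<^sup>2))"
    unfolding energy_form_def eq integral_complex_of_real by simp
qed

lemma energy_form_hermitian: "hermitian_form (L2_pairs \<Omega>) (energy_form \<Omega> \<nu> \<sigma>)"
proof
  show "smult_subspace (L2_pairs \<Omega>)"
    by (rule L2_pairs_subspace)
next
  fix u v w assume "u \<in> L2_pairs \<Omega>" "v \<in> L2_pairs \<Omega>" "w \<in> L2_pairs \<Omega>"
  note int = energy_form_integrable[OF this(1,3)] energy_form_integrable[OF this(2,3)]
  have 1: "of_real (\<nu> x) * (\<Sum>i\<in>UNIV. snd (u + v) x $ i * cnj (snd w x $ i))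
      = of_real (\<nu> x) * (\<Sum>i\<in>UNIV. snd u x $ i * cnj (snd w x $ i))
      + of_real (\<nu> x) * (\<Sum>i\<in>UNIV. snd v x $ i * cnj (snd w x $ i))" for x
    by (simp add: sum.distrib[symmetric] distrib_left[symmetric] distrib_right)
  have 2: "of_real (\<sigma> x) * fst (u + v) x * cnj (fst w x)
      = of_real (\<sigma> x) * fst u x * cnj (fst w x) + of_real (\<sigma> x) * fst v x * cnj (fst w x)" for x
    by (simp add: algebra_simps)
  show "energy_form \<Omega> \<nu> \<sigma> (u + v) w = energy_form \<Omega> \<nu> \<sigma> u w + energy_form \<Omega> \<nu> \<sigma> v w"
    unfolding energy_form_def 1 2 using int by simp
next
  fix v w c assume "v \<in> L2_pairs \<Omega>" "w \<in> L2_pairs \<Omega>"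
  have 1: "of_real (\<nu> x) * (\<Sum>i\<in>UNIV. snd (smult c v) x $ i * cnj (snd w x $ i))
      = c * (of_real (\<nu> x) * (\<Sum>i\<in>UNIV. snd v x $ i * cnj (snd w x $ i)))" for x
    by (simp add: smult_def sum_distrib_left mult_ac)
  have 2: "of_real (\<sigma> x) * fst (smult c v) x * cnj (fst w x)
      = c * (of_real (\<sigma> x) * fst v x * cnj (fst w x))" for x
    by (simp add: smult_def mult_ac)
  show "energy_form \<Omega> \<nu> \<sigma> (smult c v) w = c * energy_form \<Omega> \<nu> \<sigma> v w"
    unfolding energy_form_def 1 2 by (simp add: distrib_left)
next
  fix v w assume "v \<in> L2_pairs \<Omega>" "w \<in> L2_pairs \<Omega>"
  show "energy_form \<Omega> \<nu> \<sigma> w v = cnj (energy_form \<Omega> \<nu> \<sigma> v w)"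
    unfolding energy_form_def
    by (simp add: Bochner_Integration.integral_cnj[symmetric] mult_ac del: Bochner_Integration.integral_cnj)
next
  fix v assume v: "v \<in> L2_pairs \<Omega>"
  have "0 \<le> (LINT x|lebesgue_on \<Omega>. \<nu> x * (norm (snd v x))\<^sup>2)"
    "0 \<le> (LINT x|lebesgue_on \<Omega>. \<sigma> x * (norm (fst v x))\<^sup>2)"
    using \<nu> \<sigma> by (force intro!: Bochner_Integration.integral_nonneg mult_nonneg_nonneg)+
  then show "0 \<le> Re (energy_form \<Omega> \<nu> \<sigma> v v)"
    by (simp add: energy_form_self(3)[OF v])
qed

lemma energy_norm_bounds:
  assumes v: "v \<in> L2_pairs \<Omega>"
  shows "sqrt (min \<nu>\<^sub>l \<sigma>\<^sub>l) * h1_norm \<Omega> v \<le> energy_norm (energy_form \<Omega> \<nu> \<sigma>) v"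
    and "energy_norm (energy_form \<Omega> \<nu> \<sigma>) v \<le> sqrt (max \<nu>\<^sub>u \<sigma>\<^sub>u) * h1_norm \<Omega> v"
proof -
  let ?I = "\<lambda>g. LINT x|lebesgue_on \<Omega>. g x"
  have int: "integrable (lebesgue_on \<Omega>) (\<lambda>x. c * (norm (fst v x))\<^sup>2)"
    "integrable (lebesgue_on \<Omega>) (\<lambda>x. c * (norm (snd v x))\<^sup>2)" for c
    using v by (auto simp: L2_pairs_def square_integrable_def)
  have "min \<nu>\<^sub>l \<sigma>\<^sub>l * ?I (\<lambda>x. (norm (fst v x))\<^sup>2) \<le> ?I (\<lambda>x. \<sigma> x * (norm (fst v x))\<^sup>2)"
    unfolding integral_mult_right_zero[symmetric] using \<sigma>(3)
    by (intro integral_mono int energy_form_self v mult_right_mono) (auto simp: min.coboundedI2)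
  moreover have "min \<nu>\<^sub>l \<sigma>\<^sub>l * ?I (\<lambda>x. (norm (snd v x))\<^sup>2) \<le> ?I (\<lambda>x. \<nu> x * (norm (snd v x))\<^sup>2)"
    unfolding integral_mult_right_zero[symmetric] using \<nu>(3)
    by (intro integral_mono int energy_form_self v mult_right_mono) (auto simp: min.coboundedI1)
  ultimately show "sqrt (min \<nu>\<^sub>l \<sigma>\<^sub>l) * h1_norm \<Omega> v \<le> energy_norm (energy_form \<Omega> \<nu> \<sigma>) v"
    unfolding energy_norm_def h1_norm_def energy_form_self(3)[OF v] real_sqrt_mult[symmetric]
    by (intro real_sqrt_le_mono) (simp add: distrib_left)
  have "?I (\<lambda>x. \<sigma> x * (norm (fst v x))\<^sup>2) \<le> max \<nu>\<^sub>u \<sigma>\<^sub>u * ?I (\<lambda>x. (norm (fst v x))\<^sup>2)"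
    unfolding integral_mult_right_zero[symmetric] using \<sigma>(3)
    by (intro integral_mono int energy_form_self v mult_right_mono) (auto simp: max.coboundedI2)
  moreover have "?I (\<lambda>x. \<nu> x * (norm (snd v x))\<^sup>2) \<le> max \<nu>\<^sub>u \<sigma>\<^sub>u * ?I (\<lambda>x. (norm (snd v x))\<^sup>2)"
    unfolding integral_mult_right_zero[symmetric] using \<nu>(3)
    by (intro integral_mono int energy_form_self v mult_right_mono) (auto simp: max.coboundedI1)
  ultimately show "energy_norm (energy_form \<Omega> \<nu> \<sigma>) v \<le> sqrt (max \<nu>\<^sub>u \<sigma>\<^sub>u) * h1_norm \<Omega> v"
    unfolding energy_norm_def h1_norm_def energy_form_self(3)[OF v] real_sqrt_mult[symmetric]
    by (intro real_sqrt_le_mono) (simp add: distrib_left)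
qed

end

text \<open>With unit coefficients the energy form is the inner product behind
  \<open>h1_norm\<close>, so the norm inherits all facts about Hermitian forms.\<close>

definition h1_form :: "(real^'n::finite) set \<Rightarrow> 'n h1 \<Rightarrow> 'n h1 \<Rightarrow> complex" where
  "h1_form \<Omega> = energy_form \<Omega> (\<lambda>_. 1) (\<lambda>_. 1)"

lemma coefficients_one: "coefficients \<Omega> (\<lambda>_. 1) (\<lambda>_. 1) 1 1 1 1"
  by unfold_locales auto

lemma h1_form_hermitian: "hermitian_form (L2_pairs \<Omega>) (h1_form \<Omega>)"
  unfolding h1_form_def by (rule coefficients.energy_form_hermitian[OF coefficients_one])

text \<open>For unit coefficients the two energy bounds have the same constant 1 and pinch to an
  equality.\<close>

lemma h1_norm_eq_energy_norm: "w \<in> L2_pairs \<Omega> \<Longrightarrow> h1_norm \<Omega> w = energy_norm (h1_form \<Omega>) w"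
  using coefficients.energy_norm_bounds[OF coefficients_one, of w \<Omega>] by (simp add: h1_form_def)

section \<open>The spaces H^1, H^1_0 and H^1_p are linear subspaces\<close>

lemma times_differentiable_continuous:
  "times_differentiable m \<psi> \<Longrightarrow> continuous_on UNIV \<psi>"
  by (cases m) (auto simp: continuous_on_eq_continuous_at differentiable_imp_continuous_within)

lemma pderivative_add:
  assumes "\<psi> differentiable (at x)" "\<xi> differentiable (at x)"
  shows "pderivative i (\<psi> + \<xi>) x = pderivative i \<psi> x + pderivative i \<xi> x"
proof -
  have "((\<psi> + \<xi>) has_derivative
      (\<lambda>y. frechet_derivative \<psi> (at x) y + frechet_derivative \<xi> (at x) y)) (at x)"
    unfolding plus_fun_def
    by (intro has_derivative_add) (use assms in \<open>auto simp: frechet_derivative_works\<close>)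
  from frechet_derivative_at[OF this, symmetric] show ?thesis
    by (simp add: pderivative_def)
qed

lemma pderivative_cmult:
  assumes "\<psi> differentiable (at x)"
  shows "pderivative i (\<lambda>x. c * \<psi> x) x = c * pderivative i \<psi> x"
proof -
  have "((\<lambda>x. c * \<psi> x) has_derivative (\<lambda>y. c * frechet_derivative \<psi> (at x) y)) (at x)"
    by (intro has_derivative_mult_right) (use assms in \<open>auto simp: frechet_derivative_works\<close>)
  from frechet_derivative_at[OF this, symmetric] show ?thesis
    by (simp add: pderivative_def)
qed

lemma times_differentiable_add:
  "times_differentiable m \<psi> \<Longrightarrow> times_differentiable m \<xi> \<Longrightarrow> times_differentiable m (\<psi> + \<xi>)"
proof (induction m arbitrary: \<psi> \<xi>)
  case 0
  then show ?case by (auto simp: plus_fun_def intro: continuous_intros)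
next
  case (Suc m)
  then have "pderivative i (\<psi> + \<xi>) = pderivative i \<psi> + pderivative i \<xi>" for i
    by (auto simp: fun_eq_iff pderivative_add)
  then show ?case
    using Suc by (auto simp: plus_fun_def)
qed

lemma times_differentiable_cmult:
  "times_differentiable m \<psi> \<Longrightarrow> times_differentiable m (\<lambda>x. c * \<psi> x)"
proof (induction m arbitrary: \<psi>)
  case 0
  then show ?case by (auto intro: continuous_intros)
next
  case (Suc m)
  then have "pderivative i (\<lambda>x. c * \<psi> x) = (\<lambda>x. c * pderivative i \<psi> x)" for i
    by (auto simp: fun_eq_iff pderivative_cmult)
  then show ?case
    using Suc by (auto intro: derivative_intros)
qed

lemma smooth_zero: "smooth (0 :: real^'n::finite \<Rightarrow> complex)"
proof -
  have "times_differentiable m (0 :: real^'n \<Rightarrow> complex)" for m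
  proof (induction m)
    case (Suc m)
    have "pderivative i 0 = (0 :: real^'n \<Rightarrow> complex)" for i
      by (simp add: pderivative_def fun_eq_iff zero_fun_def)
    moreover have "(0 :: real^'n \<Rightarrow> complex) differentiable (at x)" for x
      by (simp add: zero_fun_def)
    ultimately show ?case
      using Suc by (simp only: times_differentiable.simps simp_thms)
  qed (auto simp: zero_fun_def)
  then show ?thesis by (simp add: smooth_def)
qed

lemma smooth_differentiable:
  assumes "smooth \<psi>"
  shows "\<psi> differentiable (at x)" "continuous_on UNIV \<psi>" "continuous_on UNIV (pderivative i \<psi>)"
proof -
  have "times_differentiable (Suc 0) \<psi>"
    using assms by (simp only: smooth_def)
  then show "\<psi> differentiable (at x)" "continuous_on UNIV (pderivative i \<psi>)"
    by auto
  show "continuous_on UNIV \<psi>"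
    using assms times_differentiable_continuous by (auto simp: smooth_def)
qed

lemma grad_add: "smooth \<psi> \<Longrightarrow> smooth \<xi> \<Longrightarrow> grad (\<psi> + \<xi>) = grad \<psi> + grad \<xi>"
  by (auto simp: grad_def fun_eq_iff vec_eq_iff pderivative_add smooth_differentiable)

lemma grad_cmult: "smooth \<psi> \<Longrightarrow> grad (\<lambda>x. c * \<psi> x) = (\<lambda>x. c *s grad \<psi> x)"
  by (auto simp: grad_def fun_eq_iff vec_eq_iff pderivative_cmult smooth_differentiable)

text \<open>Collects what the closure argument requires of the approximating class, so that the
  Dirichlet and periodic cases share one proof.\<close>

definition smooth_subspace :: "(real^'n::finite \<Rightarrow> complex) set \<Rightarrow> bool" where
  "smooth_subspace D \<longleftrightarrow> 0 \<in> D \<and> (\<forall>\<psi>\<in>D. smooth \<psi>) \<and>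
     (\<forall>\<psi>\<in>D. \<forall>\<xi>\<in>D. \<psi> + \<xi> \<in> D) \<and> (\<forall>c. \<forall>\<psi>\<in>D. (\<lambda>x. c * \<psi> x) \<in> D)"

lemma smooth_subspace_periodic: "smooth_subspace (periodic_functions lo hi)"
  unfolding smooth_subspace_def periodic_functions_def
  by (auto simp: smooth_zero)
     (auto simp: smooth_def times_differentiable_add times_differentiable_cmult)

text \<open>Sums and multiples are nonzero only where some given function is, so their supports are
  closed subsets of a compact set inside \<Omega>.\<close>

lemma smooth_subspace_test: "smooth_subspace (test_functions \<Omega>)"
proof -
  have *: "compact (closure S)" "closure S \<subseteq> \<Omega>"
    if "S \<subseteq> T" "compact (closure T)" "closure T \<subseteq> \<Omega>" for S T :: "(real^'a) set"
  proof -
    have "closure S \<subseteq> closure T"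
      using that(1) by (rule closure_mono)
    then show "compact (closure S)" "closure S \<subseteq> \<Omega>"
      using that bounded_subset[of "closure T" "closure S"]
      by (simp_all add: compact_eq_bounded_closed)
  qed
  have add: "\<psi> + \<xi> \<in> test_functions \<Omega>"
    if "\<psi> \<in> test_functions \<Omega>" "\<xi> \<in> test_functions \<Omega>" for \<psi> \<xi>
  proof -
    have s: "{x. (\<psi> + \<xi>) x \<noteq> 0} \<subseteq> {x. \<psi> x \<noteq> 0} \<union> {x. \<xi> x \<noteq> 0}"
      by auto
    have "compact (closure ({x. \<psi> x \<noteq> 0} \<union> {x. \<xi> x \<noteq> 0}))"
      "closure ({x. \<psi> x \<noteq> 0} \<union> {x. \<xi> x \<noteq> 0}) \<subseteq> \<Omega>"
      using that by (auto simp: test_functions_def closure_Un)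
    from *[OF s this] that show ?thesis
      by (auto simp: test_functions_def smooth_def times_differentiable_add)
  qed
  have scale: "(\<lambda>x. c * \<psi> x) \<in> test_functions \<Omega>" if "\<psi> \<in> test_functions \<Omega>" for c \<psi>
  proof -
    have s: "{x. c * \<psi> x \<noteq> 0} \<subseteq> {x. \<psi> x \<noteq> 0}"
      by auto
    have "compact (closure {x. \<psi> x \<noteq> 0})" "closure {x. \<psi> x \<noteq> 0} \<subseteq> \<Omega>"
      using that by (auto simp: test_functions_def)
    from *[OF s this] that show ?thesis
      by (auto simp: test_functions_def smooth_def times_differentiable_cmult)
  qed
  have "0 \<in> test_functions \<Omega>"
    by (simp add: test_functions_def smooth_zero)
  then show ?thesis
    using add scale by (auto simp: smooth_subspace_def test_functions_def)
qed

text \<open>Continuity on the whole space gives integrability over the compact closed box, which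
  restricts to the open one. Continuity on the open box alone would allow blow-up at the
  boundary.\<close>

lemma continuous_square_integrable:
  fixes g :: "real^'n::finite \<Rightarrow> 'b::euclidean_space"
  assumes "continuous_on UNIV g"
  shows "square_integrable (box lo hi) g"
proof -
  have "continuous_on (cbox lo hi) (\<lambda>x. (norm (g x))\<^sup>2)"
    by (intro continuous_intros continuous_on_subset[OF assms]) auto
  then have "integrable (lebesgue_on (cbox lo hi)) (\<lambda>x. (norm (g x))\<^sup>2)"
    by (rule continuous_imp_integrable)
  then have "integrable (lebesgue_on (box lo hi)) (\<lambda>x. (norm (g x))\<^sup>2)"
    using set_integrable_subset[of lebesgue "cbox lo hi" "\<lambda>x. (norm (g x))\<^sup>2" "box lo hi"]
    by (simp add: integrable_restrict_space set_integrable_def box_subset_cbox)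
  moreover have "g \<in> borel_measurable (lebesgue_on (box lo hi))"
    by (intro continuous_imp_measurable_on_sets_lebesgue continuous_on_subset[OF assms]) auto
  ultimately show ?thesis
    by (simp add: square_integrable_def)
qed

lemma smooth_pair_L2:
  assumes "smooth \<psi>"
  shows "(\<psi>, grad \<psi>) \<in> L2_pairs (box lo hi)"
proof -
  have "continuous_on UNIV (grad \<psi>)"
    unfolding grad_def by (intro continuous_intros smooth_differentiable(3)[OF assms])
  then show ?thesis
    using smooth_differentiable(2)[OF assms]
    by (simp add: L2_pairs_def continuous_square_integrable)
qed

lemma H1_subset_L2_pairs: "H1 \<Omega> \<subseteq> L2_pairs \<Omega>"
  by (auto simp: H1_def L2_pairs_def)

lemma integrable_mult_continuous:
  fixes u \<psi> :: "real^'n::finite \<Rightarrow> complex"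
  assumes "square_integrable (box lo hi) u" "continuous_on UNIV \<psi>"
  shows "integrable (lebesgue_on (box lo hi)) (\<lambda>x. u x * \<psi> x)"
proof -
  have "square_integrable (box lo hi) (\<lambda>x. cnj (\<psi> x))"
    by (intro continuous_square_integrable continuous_intros assms)
  from integrable_weighted_product[OF assms(1) this, of "\<lambda>_. 1" 1] show ?thesis
    by simp
qed

text \<open>Adding two weak-derivative identities requires their integrals to converge: test
  functions and their derivatives are continuous, hence square-integrable on the bounded box, and
  products of square-integrable functions are integrable.\<close>

lemma H1_subspace: "smult_subspace (H1 (box lo hi))"
proof -
  note X = smult_subspaceD[OF L2_pairs_subspace[of "box lo hi"]]
  have int: "integrable (lebesgue_on (box lo hi)) (\<lambda>x. fst w x * pderivative i \<psi> x)"
    "integrable (lebesgue_on (box lo hi)) (\<lambda>x. snd w x $ i * \<psi> x)"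
    if "w \<in> L2_pairs (box lo hi)" "\<psi> \<in> test_functions (box lo hi)" for w \<psi> i
    using that by (auto simp: L2_pairs_def test_functions_def
        intro!: integrable_mult_continuous smooth_differentiable square_integrable_component)
  have H1: "w \<in> H1 (box lo hi) \<longleftrightarrow> w \<in> L2_pairs (box lo hi) \<and>
     (\<forall>\<psi>\<in>test_functions (box lo hi). \<forall>i.
        (LINT x|lebesgue_on (box lo hi). fst w x * pderivative i \<psi> x) =
        - (LINT x|lebesgue_on (box lo hi). snd w x $ i * \<psi> x))" for w
    by (auto simp: H1_def L2_pairs_def split: prod.splits)
  show ?thesis
    unfolding smult_subspace_def
  proof (intro conjI ballI allI)
    show "0 \<in> H1 (box lo hi)"
      by (simp add: H1 X)
  next
    fix v w assume vw: "v \<in> H1 (box lo hi)" "w \<in> H1 (box lo hi)"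
    then have "v \<in> L2_pairs (box lo hi)" "w \<in> L2_pairs (box lo hi)"
      by (auto simp: H1)
    note i = int[OF this(1)] int[OF this(2)]
    show "v + w \<in> H1 (box lo hi)"
      using vw i by (simp add: H1 X distrib_right)
  next
    fix v c assume v: "v \<in> H1 (box lo hi)"
    then show "smult c v \<in> H1 (box lo hi)"
      by (simp add: H1 X) (simp add: smult_def mult.assoc)
  qed
qed

text \<open>Approximants are added and scaled along with their gradients; the resulting errors are
  estimated in the Hermitian form on \<open>L2_pairs\<close>.\<close>

lemma H1_closure_subspace:
  assumes D: "smooth_subspace D"
  shows "smult_subspace (H1_closure (box lo hi) D)"
proof -
  let ?\<Omega> = "box lo hi"
  interpret h: hermitian_form "L2_pairs ?\<Omega>" "h1_form ?\<Omega>"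
    by (rule h1_form_hermitian)
  note X = h.closed and H = smult_subspaceD[OF H1_subspace[of lo hi]]
  have mem: "w - (\<psi>, grad \<psi>) \<in> L2_pairs ?\<Omega>" if "w \<in> H1 ?\<Omega>" "\<psi> \<in> D" for w \<psi>
    using that D H1_subset_L2_pairs[of ?\<Omega>] smooth_pair_L2[of \<psi> lo hi]
    by (intro X(5)) (auto simp: smooth_subspace_def)
  show ?thesis
    unfolding smult_subspace_def
  proof (intro conjI ballI allI)
    have "grad 0 = (0 :: real^'a \<Rightarrow> complex^'a)"
      by (simp add: grad_def pderivative_def fun_eq_iff vec_eq_iff zero_fun_def)
    then have "h1_norm ?\<Omega> (0 - (0, grad 0)) = 0"
      using h.energy_norm_zero h1_norm_eq_energy_norm[OF X(1)] by (simp add: zero_prod_def[symmetric])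
    moreover have "0 \<in> D"
      using D by (simp add: smooth_subspace_def)
    ultimately show "0 \<in> H1_closure ?\<Omega> D"
      unfolding H1_closure_def using H(1) by (auto intro!: bexI[of _ 0])
  next
    fix v w assume vw: "v \<in> H1_closure ?\<Omega> D" "w \<in> H1_closure ?\<Omega> D"
    have "\<exists>\<psi>\<in>D. h1_norm ?\<Omega> (v + w - (\<psi>, grad \<psi>)) < e" if "0 < e" for e
    proof -
      obtain \<psi> \<xi> where p: "\<psi> \<in> D" "h1_norm ?\<Omega> (v - (\<psi>, grad \<psi>)) < e / 2"
        and q: "\<xi> \<in> D" "h1_norm ?\<Omega> (w - (\<xi>, grad \<xi>)) < e / 2"
        using vw \<open>0 < e\<close> unfolding H1_closure_def mem_Collect_eq by (meson half_gt_zero)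
      have m: "v - (\<psi>, grad \<psi>) \<in> L2_pairs ?\<Omega>" "w - (\<xi>, grad \<xi>) \<in> L2_pairs ?\<Omega>"
        using vw p q mem by (auto simp: H1_closure_def)
      have pq: "\<psi> + \<xi> \<in> D" "grad (\<psi> + \<xi>) = grad \<psi> + grad \<xi>"
        using D p(1) q(1) by (auto simp: smooth_subspace_def grad_add)
      have "v + w - (\<psi> + \<xi>, grad (\<psi> + \<xi>)) = (v - (\<psi>, grad \<psi>)) + (w - (\<xi>, grad \<xi>))"
        unfolding pq(2) by (simp add: prod_eq_iff)
      then have "h1_norm ?\<Omega> (v + w - (\<psi> + \<xi>, grad (\<psi> + \<xi>))) < e"
        using h.energy_norm_triangle[OF m] p(2) q(2) h1_norm_eq_energy_norm[OF X(2)[OF m]]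
          h1_norm_eq_energy_norm[OF m(1)] h1_norm_eq_energy_norm[OF m(2)]
        by (simp only:)
      then show ?thesis using pq(1) by blast
    qed
    then show "v + w \<in> H1_closure ?\<Omega> D"
      using vw H by (auto simp: H1_closure_def)
  next
    fix v c assume v: "v \<in> H1_closure ?\<Omega> D"
    have "\<exists>\<psi>\<in>D. h1_norm ?\<Omega> (smult c v - (\<psi>, grad \<psi>)) < e" if e: "0 < e" for e
    proof -
      \<comment> \<open>Dividing by \<open>cmod c + 1\<close> rather than by \<open>cmod c\<close>
        covers \<open>c = 0\<close> as well.\<close>
      have "0 < e / (cmod c + 1)"
        using e by (intro divide_pos_pos) (auto intro: add_nonneg_pos)
      then obtain \<psi> where p: "\<psi> \<in> D" "h1_norm ?\<Omega> (v - (\<psi>, grad \<psi>)) < e / (cmod c + 1)"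
        using v by (auto simp: H1_closure_def)
      let ?\<xi> = "\<lambda>x. c * \<psi> x"
      have m: "v - (\<psi>, grad \<psi>) \<in> L2_pairs ?\<Omega>"
        using v p mem by (auto simp: H1_closure_def)
      have pq: "?\<xi> \<in> D" "grad ?\<xi> = (\<lambda>x. c *s grad \<psi> x)"
        using D p(1) by (auto simp: smooth_subspace_def grad_cmult)
      have "smult c v - (?\<xi>, grad ?\<xi>) = smult c (v - (\<psi>, grad \<psi>))"
        by (simp add: pq smult_def prod_eq_iff fun_eq_iff vec_eq_iff algebra_simps)
      then have "h1_norm ?\<Omega> (smult c v - (?\<xi>, grad ?\<xi>)) = cmod c * h1_norm ?\<Omega> (v - (\<psi>, grad \<psi>))"
        using h.energy_norm_smult[OF m] m X(3)[OF m] by (simp add: h1_norm_eq_energy_norm)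
      also have "\<dots> \<le> (cmod c + 1) * h1_norm ?\<Omega> (v - (\<psi>, grad \<psi>))"
        using h.energy_norm_nonneg[OF m] m by (intro mult_right_mono) (auto simp: h1_norm_eq_energy_norm)
      also have "\<dots> < (cmod c + 1) * (e / (cmod c + 1))"
        using p(2) by (intro mult_strict_left_mono) (auto intro: add_nonneg_pos)
      also have "\<dots> = e"
        by (smt (verit) nonzero_mult_div_cancel_left norm_ge_zero times_divide_eq_right)
      finally show ?thesis using pq(1) by blast
    qed
    then show "smult c v \<in> H1_closure ?\<Omega> D"
      using v H by (auto simp: H1_closure_def)
  qed
qed

section \<open>Galerkin spaces\<close>

lemma galerkin_space_subspace: "smult_subspace (galerkin_space \<phi> \<Lambda>)"
proof -
  have "0 \<in> galerkin_space \<phi> \<Lambda>"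
    unfolding galerkin_space_def by (rule range_eqI[of _ _ "\<lambda>_. 0"]) (simp add: smult_zero)
  moreover have "v + w \<in> galerkin_space \<phi> \<Lambda>"
    if vw: "v \<in> galerkin_space \<phi> \<Lambda>" "w \<in> galerkin_space \<phi> \<Lambda>" for v w
  proof -
    obtain b c where "v = (\<Sum>k\<in>\<Lambda>. smult (b k) (\<phi> k))" "w = (\<Sum>k\<in>\<Lambda>. smult (c k) (\<phi> k))"
      using vw by (auto simp: galerkin_space_def)
    then have "v + w = (\<Sum>k\<in>\<Lambda>. smult (b k + c k) (\<phi> k))"
      by (simp add: smult_add_left sum.distrib)
    then show ?thesis
      unfolding galerkin_space_def by (intro range_eqI[where x = "\<lambda>k. b k + c k"])
  qed
  moreover have "smult t v \<in> galerkin_space \<phi> \<Lambda>" if v: "v \<in> galerkin_space \<phi> \<Lambda>" for t v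
  proof -
    obtain b where "v = (\<Sum>k\<in>\<Lambda>. smult (b k) (\<phi> k))"
      using v by (auto simp: galerkin_space_def)
    then have "smult t v = (\<Sum>k\<in>\<Lambda>. smult (t * b k) (\<phi> k))"
      by (simp add: smult_sum smult_smult)
    then show ?thesis
      unfolding galerkin_space_def by (intro range_eqI[where x = "\<lambda>k. t * b k"])
  qed
  ultimately show ?thesis
    by (simp add: smult_subspace_def)
qed

text \<open>Coefficients are extended by 0. Finiteness of the larger set matters because a sum over
  an infinite set is 0 by convention.\<close>

lemma galerkin_space_mono:
  assumes "finite \<Lambda>'" "\<Lambda> \<subseteq> \<Lambda>'"
  shows "galerkin_space \<phi> \<Lambda> \<subseteq> galerkin_space \<phi> \<Lambda>'"
proof
  fix v assume "v \<in> galerkin_space \<phi> \<Lambda>"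
  then obtain b where "v = (\<Sum>k\<in>\<Lambda>. smult (b k) (\<phi> k))"
    by (auto simp: galerkin_space_def)
  also have "\<dots> = (\<Sum>k\<in>\<Lambda>'. smult (if k \<in> \<Lambda> then b k else 0) (\<phi> k))"
    by (rule sum.mono_neutral_cong_left) (use assms in \<open>auto simp: smult_zero\<close>)
  finally show "v \<in> galerkin_space \<phi> \<Lambda>'"
    unfolding galerkin_space_def by (intro range_eqI[where x = "\<lambda>k. if k \<in> \<Lambda> then b k else 0"])
qed

text \<open>Each coordinate differs from that of \<open>l\<close> by at most the ceiling of
  \<open>J\<close>, so the ball lies in a finite integer box. This keeps the enriched index sets
  finite.\<close>

lemma finite_znorm_ball: "finite {k :: int^'n::finite. znorm (k - l) \<le> J}"
proof (rule finite_subset)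
  let ?I = "\<lambda>i. {l $ i - \<lceil>J\<rceil>..l $ i + \<lceil>J\<rceil>}"
  show "finite ((\<lambda>g. \<chi> i. g i) ` (\<Pi>\<^sub>E i\<in>UNIV. ?I i))"
    by (intro finite_imageI finite_PiE) auto
  show "{k. znorm (k - l) \<le> J} \<subseteq> (\<lambda>g. \<chi> i. g i) ` (\<Pi>\<^sub>E i\<in>UNIV. ?I i)"
  proof
    fix k assume "k \<in> {k. znorm (k - l) \<le> J}"
    then have k: "znorm (k - l) \<le> J" by simp
    have "k $ i \<in> ?I i" for i
    proof -
      have "\<bar>real_of_int (k $ i - l $ i)\<bar> \<le> znorm (k - l)"
        unfolding znorm_def
        using Finite_Cartesian_Product.norm_nth_le[of "\<chi> i. real_of_int ((k - l) $ i)" i] by simp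
      then have "real_of_int \<bar>k $ i - l $ i\<bar> \<le> J"
        using k by simp
      then have "\<bar>k $ i - l $ i\<bar> \<le> \<lceil>J\<rceil>"
        by linarith
      then show ?thesis by auto
    qed
    then show "k \<in> (\<lambda>g. \<chi> i. g i) ` (\<Pi>\<^sub>E i\<in>UNIV. ?I i)"
      by (intro image_eqI[of _ _ "\<lambda>i. k $ i"]) (auto simp: vec_eq_iff)
  qed
qed

lemma finite_enrichment:
  assumes "finite M"
  shows "finite (enrichment K J M)"
proof (rule finite_subset)
  show "enrichment K J M \<subseteq> (\<Union>l\<in>M. {k. znorm (k - l) \<le> J})"
    by (auto simp: enrichment_def)
qed (use assms finite_znorm_ball in auto)

section \<open>One step of DYN-GAL\<close>

locale elliptic_problem = coefficients \<Omega> \<nu> \<sigma> \<nu>\<^sub>l \<nu>\<^sub>u \<sigma>\<^sub>l \<sigma>\<^sub>u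
  for \<Omega> :: "(real^'n::finite) set" and \<nu> \<sigma> \<nu>\<^sub>l \<nu>\<^sub>u \<sigma>\<^sub>l \<sigma>\<^sub>u +
  fixes V :: "'n h1 set" and K :: "(int^'n) set" and \<phi> :: "int^'n \<Rightarrow> 'n h1"
    and d :: "int^'n \<Rightarrow> real" and \<beta>\<^sub>l \<beta>\<^sub>u :: real
  assumes V_subspace: "smult_subspace V" and V_L2: "V \<subseteq> L2_pairs \<Omega>"
    and \<nu>\<^sub>u_pos: "0 < \<nu>\<^sub>u"
    and riesz_basis: "riesz_basis \<Omega> V K \<phi> d \<beta>\<^sub>l \<beta>\<^sub>u"
begin

definition a :: "'n h1 \<Rightarrow> 'n h1 \<Rightarrow> complex" where
  "a = energy_form \<Omega> \<nu> \<sigma>"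

text \<open>In this scaling the stiffness matrix is the Gram matrix of the basis and the weighted
  norms of coefficients become plain sequence norms.\<close>

definition \<psi> :: "int^'n \<Rightarrow> 'n h1" where
  "\<psi> k = smult (of_real (1 / sqrt (d k))) (\<phi> k)"

definition \<alpha>\<^sub>l :: real where "\<alpha>\<^sub>l = min \<nu>\<^sub>l \<sigma>\<^sub>l"

definition \<alpha>\<^sub>u :: real where "\<alpha>\<^sub>u = max \<nu>\<^sub>u \<sigma>\<^sub>u"

lemma combination_\<psi>:
  "combination \<psi> F x = (\<Sum>k\<in>F. smult (x k / of_real (sqrt (d k))) (\<phi> k))"
  by (simp add: combination_def \<psi>_def smult_smult)

lemma weights: "k \<in> K \<Longrightarrow> \<phi> k \<in> V" "k \<in> K \<Longrightarrow> 0 < d k"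
  using riesz_basis by (auto simp: riesz_basis_def)

lemma riesz_basisD:
  assumes "v \<in> V" "expansion \<Omega> K \<phi> v c"
  shows "(\<lambda>k. (cmod (c k))\<^sup>2 * d k) summable_on K"
    "\<beta>\<^sub>l * h1_norm \<Omega> v \<le> sqrt (\<Sum>\<^sub>\<infinity>k\<in>K. (cmod (c k))\<^sup>2 * d k)"
    "sqrt (\<Sum>\<^sub>\<infinity>k\<in>K. (cmod (c k))\<^sup>2 * d k) \<le> \<beta>\<^sub>u * h1_norm \<Omega> v"
  using riesz_basis assms by (simp_all add: riesz_basis_def)

lemma \<psi>_mem: "k \<in> K \<Longrightarrow> \<psi> k \<in> V"
  unfolding \<psi>_def by (intro smult_subspaceD(3)[OF V_subspace] weights)

text \<open>Passing from \<phi> to \<psi> multiplies the coefficients by \<open>sqrt (d k)\<close>;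
  on \<open>K\<close>, where the weights are positive, the partial sums are unchanged.\<close>

lemma expansion_iff:
  assumes "v \<in> V"
  shows "expansion \<Omega> K \<phi> v c \<longleftrightarrow>
    ((\<lambda>F. energy_norm (h1_form \<Omega>) (v - combination \<psi> F (\<lambda>k. of_real (sqrt (d k)) * c k))) \<longlongrightarrow> 0)
      (finite_subsets_at_top K)"
  unfolding expansion_def
proof (rule tendsto_cong, rule eventually_finite_subsets_at_top_weakI)
  fix F assume F: "finite F" "F \<subseteq> K"
  have eq: "combination \<psi> F (\<lambda>k. of_real (sqrt (d k)) * c k) = (\<Sum>k\<in>F. smult (c k) (\<phi> k))"
    unfolding combination_\<psi>
  proof (rule sum.cong[OF refl])
    fix k assume "k \<in> F"
    then have "0 < d k" using F weights by auto
    then show "smult (of_real (sqrt (d k)) * c k / of_real (sqrt (d k))) (\<phi> k) = smult (c k) (\<phi> k)"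
      by simp
  qed
  have "(\<Sum>k\<in>F. smult (c k) (\<phi> k)) \<in> V"
    using F weights by (intro smult_subspaceD(6,3)[OF V_subspace]) auto
  then have "v - (\<Sum>k\<in>F. smult (c k) (\<phi> k)) \<in> L2_pairs \<Omega>"
    using smult_subspaceD(5)[OF V_subspace] assms V_L2 by blast
  then show "h1_norm \<Omega> (v - (\<Sum>k\<in>F. smult (c k) (\<phi> k))) =
      energy_norm (h1_form \<Omega>) (v - combination \<psi> F (\<lambda>k. of_real (sqrt (d k)) * c k))"
    by (simp add: eq h1_norm_eq_energy_norm)
qed

sublocale coercive_riesz V a "h1_form \<Omega>" K \<psi> \<alpha>\<^sub>l \<alpha>\<^sub>u \<beta>\<^sub>l \<beta>\<^sub>u
proof -
  interpret a: hermitian_form V a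
    unfolding a_def by (rule hermitian_form_mono[OF energy_form_hermitian V_subspace V_L2])
  interpret h: hermitian_form V "h1_form \<Omega>"
    by (rule hermitian_form_mono[OF h1_form_hermitian V_subspace V_L2])
  show "coercive_riesz V a (h1_form \<Omega>) K \<psi> \<alpha>\<^sub>l \<alpha>\<^sub>u \<beta>\<^sub>l \<beta>\<^sub>u"
  proof
    show "0 < \<alpha>\<^sub>l" "0 < \<alpha>\<^sub>u"
      using \<nu>(2) \<sigma>(2) \<nu>\<^sub>u_pos by (auto simp: \<alpha>\<^sub>l_def \<alpha>\<^sub>u_def)
    show "0 < \<beta>\<^sub>l" "0 < \<beta>\<^sub>u"
      using riesz_basis by (auto simp: riesz_basis_def)
    show "\<psi> k \<in> V" if "k \<in> K" for k
      using that by (rule \<psi>_mem)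
  next
    fix v assume "v \<in> V"
    then have v: "v \<in> L2_pairs \<Omega>" using V_L2 by auto
    show "sqrt \<alpha>\<^sub>l * energy_norm (h1_form \<Omega>) v \<le> energy_norm a v"
      "energy_norm a v \<le> sqrt \<alpha>\<^sub>u * energy_norm (h1_form \<Omega>) v"
      using energy_norm_bounds[OF v] h1_norm_eq_energy_norm[OF v] by (simp_all add: a_def \<alpha>\<^sub>l_def \<alpha>\<^sub>u_def)
  next
    fix v assume v: "v \<in> V"
    then obtain c where "expansion \<Omega> K \<phi> v c"
      using riesz_basis by (auto simp: riesz_basis_def)
    then show "\<exists>x. ((\<lambda>F. energy_norm (h1_form \<Omega>) (v - combination \<psi> F x)) \<longlongrightarrow> 0)
        (finite_subsets_at_top K)"
      unfolding expansion_iff[OF v] by blast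
  next
    fix v x
    assume v: "v \<in> V" and
      x: "((\<lambda>F. energy_norm (h1_form \<Omega>) (v - combination \<psi> F x)) \<longlongrightarrow> 0) (finite_subsets_at_top K)"
    \<comment> \<open>Undoes the scaling of coefficients. Multiplying back recovers \<open>x\<close>
      only on \<open>K\<close>, which suffices since all sections lie in \<open>K\<close>.\<close>
    let ?c = "\<lambda>k. x k / of_real (sqrt (d k))"
    have xc: "of_real (sqrt (d k)) * ?c k = x k" if "k \<in> K" for k
      using weights(2)[OF that] by simp
    have "((\<lambda>F. energy_norm (h1_form \<Omega>) (v - combination \<psi> F (\<lambda>k. of_real (sqrt (d k)) * ?c k))) \<longlongrightarrow> 0)
        (finite_subsets_at_top K)"
      using x
    proof (rule Lim_transform_eventually, intro eventually_finite_subsets_at_top_weakI)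
      fix F assume "finite F" "F \<subseteq> K"
      then have "combination \<psi> F x = combination \<psi> F (\<lambda>k. of_real (sqrt (d k)) * ?c k)"
        unfolding combination_def by (intro sum.cong refl) (simp add: xc subset_eq del: times_divide_eq_right)
      then show "energy_norm (h1_form \<Omega>) (v - combination \<psi> F x) =
          energy_norm (h1_form \<Omega>) (v - combination \<psi> F (\<lambda>k. of_real (sqrt (d k)) * ?c k))"
        by simp
    qed
    then have "expansion \<Omega> K \<phi> v ?c"
      by (simp add: expansion_iff[OF v])
    note * = riesz_basisD[OF v this]
    have sq: "(cmod (?c k))\<^sup>2 * d k = (cmod (x k))\<^sup>2" if "k \<in> K" for k
      using weights(2)[OF that] by (simp add: norm_divide power_divide)
    have "(\<Sum>\<^sub>\<infinity>k\<in>K. (cmod (?c k))\<^sup>2 * d k) = (\<Sum>\<^sub>\<infinity>k\<in>K. (cmod (x k))\<^sup>2)"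
      by (rule infsum_cong[OF sq])
    moreover have "(\<lambda>k. (cmod (x k))\<^sup>2) summable_on K"
      using *(1) sq by (rule summable_on_cong[THEN iffD1, rotated])
    moreover have "h1_norm \<Omega> v = energy_norm (h1_form \<Omega>) v"
      using v V_L2 by (intro h1_norm_eq_energy_norm) auto
    ultimately show "(\<lambda>k. (cmod (x k))\<^sup>2) summable_on K \<and>
      \<beta>\<^sub>l * energy_norm (h1_form \<Omega>) v \<le> l2_norm K x \<and> l2_norm K x \<le> \<beta>\<^sub>u * energy_norm (h1_form \<Omega>) v"
      using *(2,3) by (simp add: l2_norm_def)
  qed
qed

section \<open>Dual norm, dual projection and stiffness matrix in the rescaled basis\<close>

lemma dual_norm_eq_l2_norm:
  "dual_norm K \<phi> d g = l2_norm K (\<lambda>k. g (\<phi> k) / of_real (sqrt (d k)))"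
  unfolding dual_norm_def l2_norm_def
  by (rule arg_cong[where f = sqrt], rule infsum_cong)
     (simp add: norm_divide power_divide less_imp_le[OF weights(2)])

lemma form_\<psi>:
  assumes "e \<in> V" "k \<in> K"
  shows "a e (\<phi> k) / of_real (sqrt (d k)) = a e (\<psi> k)"
  using a.smult_right[OF weights(1)[OF assms(2)] assms(1)] by (simp add: \<psi>_def)

lemma dual_norm_form:
  assumes "e \<in> V" "\<And>v. v \<in> V \<Longrightarrow> g v = a e v"
  shows "dual_norm K \<phi> d g = l2_norm K (\<lambda>k. a e (\<psi> k))"
  unfolding dual_norm_eq_l2_norm
  by (rule l2_norm_cong) (simp add: assms weights form_\<psi>)

text \<open>\<open>coefficient\<close> is an arbitrary choice of expansion; the Kronecker sequence
  also expands \<open>\<phi> k\<close>, and uniqueness identifies the two on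
  \<open>K\<close>.\<close>

lemma coefficient_basis:
  assumes "k \<in> K" "l \<in> K"
  shows "coefficient \<Omega> K \<phi> (\<phi> k) l = (if l = k then 1 else 0)"
proof -
  let ?\<delta> = "\<lambda>l. if l = k then 1 else 0 :: complex"
  have k: "\<phi> k \<in> V" by (rule weights(1)[OF assms(1)])
  have "\<exists>c. expansion \<Omega> K \<phi> (\<phi> k) c"
    using riesz_basis k by (auto simp: riesz_basis_def)
  then have c: "expansion \<Omega> K \<phi> (\<phi> k) (coefficient \<Omega> K \<phi> (\<phi> k))"
    unfolding coefficient_def by (rule someI_ex)
  have "h1_norm \<Omega> (\<phi> k - (\<Sum>j\<in>F. smult (?\<delta> j) (\<phi> j))) = 0" if "finite F" "{k} \<subseteq> F" for F
  proof -
    have "(\<Sum>j\<in>F. smult (?\<delta> j) (\<phi> j)) = (\<Sum>j\<in>{k}. \<phi> j)"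
      by (rule sum.mono_neutral_cong_right) (use that in \<open>auto simp: smult_zero smult_one\<close>)
    then show ?thesis
      using h.energy_norm_zero a.closed(1) V_L2 by (simp add: h1_norm_eq_energy_norm subset_eq)
  qed
  then have "expansion \<Omega> K \<phi> (\<phi> k) ?\<delta>"
    unfolding expansion_def
    by (intro tendsto_eventually, unfold eventually_finite_subsets_at_top)
       (rule exI[of _ "{k}"], use assms in auto)
  from coefficients_unique[OF k c[unfolded expansion_iff[OF k]] this[unfolded expansion_iff[OF k]] assms(2)]
  show ?thesis
    using weights(2)[OF assms(2)] by simp
qed

text \<open>Biorthogonality turns the projection into restriction of coefficients to
  \<open>M\<close>. The marking criterion thereby becomes a bulk condition on a sequence
  norm.\<close>

lemma dual_norm_projection:
  assumes e: "e \<in> V" and g: "\<And>v. v \<in> V \<Longrightarrow> g v = a e v" and M: "finite M" "M \<subseteq> K"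
  shows "dual_norm K \<phi> d (dual_projection \<Omega> K \<phi> M g) = l2_norm M (\<lambda>k. a e (\<psi> k))"
proof -
  have proj: "dual_projection \<Omega> K \<phi> M g (\<phi> k) = (if k \<in> M then g (\<phi> k) else 0)" if "k \<in> K" for k
  proof -
    have "dual_projection \<Omega> K \<phi> M g (\<phi> k) = (\<Sum>l\<in>M. g (\<phi> l) * (if l = k then 1 else 0))"
      unfolding dual_projection_def dual_basis_def infsum_finite[OF M(1)]
      by (rule sum.cong) (use that M coefficient_basis in auto)
    also have "\<dots> = (if k \<in> M then g (\<phi> k) else 0)"
      using M(1) by (simp add: if_distrib[where f = "(*) _"] sum.delta cong: if_cong)
    finally show ?thesis .
  qed
  have "dual_norm K \<phi> d (dual_projection \<Omega> K \<phi> M g)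
      = l2_norm K (\<lambda>k. if k \<in> M then a e (\<psi> k) else 0)"
    unfolding dual_norm_eq_l2_norm
    by (rule l2_norm_cong) (simp add: proj g e weights form_\<psi>)
  then show ?thesis
    by (simp add: l2_norm_restrict[OF M(2)])
qed

lemma galerkin_space_mem: "\<Lambda> \<subseteq> K \<Longrightarrow> v \<in> galerkin_space \<phi> \<Lambda> \<Longrightarrow> v \<in> V"
  unfolding galerkin_space_def using weights(1)
  by (auto intro!: a.closed(6) a.closed(3))

lemma combination_galerkin: "combination \<psi> E y \<in> galerkin_space \<phi> E"
  unfolding galerkin_space_def combination_\<psi>
  by (intro range_eqI[where x = "\<lambda>k. y k / of_real (sqrt (d k))"] refl)

lemma stiffness_eq:
  assumes "l \<in> K" "k \<in> K"
  shows "stiffness a \<phi> d l k = a (\<psi> k) (\<psi> l)"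
proof -
  have "a (\<psi> k) (\<psi> l) = a (\<psi> k) (\<phi> l) / of_real (sqrt (d l))"
    using form_\<psi>[OF \<psi>_mem[OF assms(2)] assms(1)] by simp
  also have "a (\<psi> k) (\<phi> l) = a (\<phi> k) (\<phi> l) / of_real (sqrt (d k))"
    using a.smult_left[OF weights(1)[OF assms(2)] weights(1)[OF assms(1)]] by (simp add: \<psi>_def)
  finally show ?thesis
    by (simp add: stiffness_def mult.commute)
qed

text \<open>The two matrices agree only on \<open>K\<close>, but \<open>mat_apply\<close> and the
  summability conditions see no other entries.\<close>

lemma l2_inverse_gram:
  assumes "l2_inverse K (stiffness a \<phi> d) N"
  shows "l2_inverse K (\<lambda>l k. a (\<psi> k) (\<psi> l)) N"
proof -
  have "mat_apply K (stiffness a \<phi> d) = mat_apply K (\<lambda>l k. a (\<psi> k) (\<psi> l))"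
    unfolding mat_apply_def fun_eq_iff by (auto simp: stiffness_eq intro!: infsum_cong)
  moreover have "(\<lambda>k. stiffness a \<phi> d l k * x k) summable_on K \<longleftrightarrow>
      (\<lambda>k. a (\<psi> k) (\<psi> l) * x k) summable_on K" if "l \<in> K" for l x
    by (rule summable_on_cong) (simp add: stiffness_eq that)
  ultimately show ?thesis
    using assms unfolding l2_inverse_def l2_bounded_def by simp
qed

text \<open>Besides the estimate, the conclusions restore for the new iterate the structural
  assumptions made on the old one, so that steps can be chained.\<close>

lemma dyn_gal_step_energy_estimate:
  assumes step: "dyn_gal_step \<Omega> a f K \<phi> d \<alpha>\<^sub>l \<alpha>\<^sub>u C\<^sub>A \<eta>\<^sub>A C\<^sub>0 \<Lambda> r \<Lambda>' u' r'"
    and u: "u \<in> V" "\<And>v. v \<in> V \<Longrightarrow> a u v = f v"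
    and \<Lambda>: "finite \<Lambda>" "\<Lambda> \<subseteq> K" "w \<in> galerkin_space \<phi> \<Lambda>"
    and r: "\<And>v. v \<in> V \<Longrightarrow> r v = a (u - w) v"
    and normalised: "1 \<le> \<beta>\<^sub>l * \<beta>\<^sub>u"
    and inverse: "l2_inverse K (stiffness a \<phi> d) N"
    and decay: "\<And>J. 0 \<le> J \<Longrightarrow> l2_bounded K (\<lambda>l k. N l k - truncate J N l k) \<and>
      l2_opnorm K (\<lambda>l k. N l k - truncate J N l k) \<le> C\<^sub>A * exp (- \<eta>\<^sub>A * J)"
    and \<rho>: "0 < dual_norm K \<phi> d f" "C\<^sub>0 * dual_norm K \<phi> d r \<le> dual_norm K \<phi> d f" "0 \<le> C\<^sub>0"
  shows "finite \<Lambda>'" "\<Lambda>' \<subseteq> K" "u' \<in> galerkin_space \<phi> \<Lambda>'" "\<And>v. v \<in> V \<Longrightarrow> r' v = a (u - u') v"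
    and "energy_norm a (u - u') \<le>
      2 * (\<beta>\<^sub>u / sqrt \<alpha>\<^sub>l) * C\<^sub>0 * (dual_norm K \<phi> d r)\<^sup>2 / dual_norm K \<phi> d f"
proof -
  define \<rho>' where "\<rho>' = dual_norm K \<phi> d r"
  \<comment> \<open>This is \<open>sqrt (1 - \<theta>\<^sup>2)\<close>. The assumed bound on the
    residual gives \<open>s \<le> 1\<close>, so \<theta> is the root of a nonnegative number and
    squaring it loses nothing.\<close>
  define s where "s = C\<^sub>0 * \<rho>' / dual_norm K \<phi> d f"
  define \<theta> where "\<theta> = sqrt (1 - C\<^sub>0\<^sup>2 * \<rho>'\<^sup>2 / (dual_norm K \<phi> d f)\<^sup>2)"
  obtain M J \<delta> where
    M: "doerfler_marking \<Omega> K \<phi> d \<theta> r M" and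
    J: "0 < J" "C\<^sub>A * exp (- \<eta>\<^sub>A * J) \<le> sqrt ((1 - \<theta>\<^sup>2) / (\<alpha>\<^sub>l * \<alpha>\<^sub>u))" and
    \<Lambda>': "\<Lambda>' = \<Lambda> \<union> enrichment K J M" and
    u': "galerkin_solution a f \<phi> \<Lambda>' u'" and r': "r' = residual a f u'"
    using step unfolding dyn_gal_step_def Let_def \<theta>_def \<rho>'_def by blast
  define b where "b = (\<lambda>k. a (u - w) (\<psi> k))"
  have w: "w \<in> V" "u - w \<in> V"
    using galerkin_space_mem[OF \<Lambda>(2,3)] u a.closed(5) by auto
  have \<rho>b: "\<rho>' = l2_norm K b"
    unfolding \<rho>'_def b_def by (rule dual_norm_form[OF w(2) r])
  then have \<rho>0: "0 \<le> \<rho>'" by (simp add: l2_norm_nonneg)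
  have s: "0 \<le> s" "s \<le> 1"
    using \<rho> \<rho>0 by (auto simp: s_def \<rho>'_def divide_simps)
  have \<theta>: "\<theta> = sqrt (1 - s\<^sup>2)"
    by (simp add: \<theta>_def s_def power_mult_distrib power_divide)
  have \<theta>2: "1 - \<theta>\<^sup>2 = s\<^sup>2" "0 \<le> \<theta>"
    using s by (auto simp: \<theta> power_le_one)
  have Mfin: "finite M" "M \<subseteq> K"
    and bulk: "\<theta> * \<rho>' \<le> l2_norm M b"
    using M dual_norm_projection[OF w(2) r, of M]
    by (auto simp: doerfler_marking_def doerfler_set_def \<rho>'_def b_def)
  let ?E = "enrichment K J M"
  have E: "finite ?E" "?E \<subseteq> K"
    using finite_enrichment[OF Mfin(1)] by (auto simp: enrichment_def)
  show fin: "finite \<Lambda>'" and sub: "\<Lambda>' \<subseteq> K"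
    using \<Lambda>' \<Lambda> E by auto
  show gal: "u' \<in> galerkin_space \<phi> \<Lambda>'"
    using u' by (simp add: galerkin_solution_def)
  have u'V: "u' \<in> V"
    using galerkin_space_mem[OF sub gal] .
  show "r' v = a (u - u') v" if "v \<in> V" for v
    using that u u'V by (simp add: r' residual_def a.diff_left)
  have bs: "(\<lambda>k. (cmod (b k))\<^sup>2) summable_on K"
    unfolding b_def by (rule residual_l2_norm(1)[OF w(2)])
  \<comment> \<open>Pythagoras for the disjoint index sets \<open>M\<close> and \<open>K - M\<close>
    turns the bulk condition into a bound on the unmarked part.\<close>
  have rest: "l2_norm (K - M) b \<le> s * \<rho>'"
  proof (rule power2_le_imp_le)
    have "(\<theta> * \<rho>')\<^sup>2 \<le> (l2_norm M b)\<^sup>2"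
      using bulk \<theta>2 \<rho>0 by (intro power_mono) auto
    moreover have "(l2_norm (K - M) b)\<^sup>2 = \<rho>'\<^sup>2 - (l2_norm M b)\<^sup>2"
      using l2_norm_split[OF bs Mfin(2)] \<rho>b by simp
    ultimately have "(l2_norm (K - M) b)\<^sup>2 \<le> (1 - \<theta>\<^sup>2) * \<rho>'\<^sup>2"
      by (simp add: power_mult_distrib left_diff_distrib)
    then show "(l2_norm (K - M) b)\<^sup>2 \<le> (s * \<rho>')\<^sup>2"
      by (simp add: \<theta>2 power_mult_distrib)
  qed (use s \<rho>0 in auto)
  have marked: "l2_norm M b \<le> \<rho>'"
    using l2_norm_mono_set[OF bs Mfin(2)] \<rho>b by simp
  \<comment> \<open>The right-hand side in the choice of \<open>J\<close>, written with
    \<open>s\<close>. Its factor \<open>sqrt \<alpha>\<^sub>u\<close> in the denominator later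
    cancels the one from the upper energy bound.\<close>
  define \<tau> where "\<tau> = s / (sqrt \<alpha>\<^sub>l * sqrt \<alpha>\<^sub>u)"
  have "C\<^sub>A * exp (- \<eta>\<^sub>A * J) \<le> \<tau>"
    using J(2) s by (simp add: \<theta>2 \<tau>_def real_sqrt_divide real_sqrt_mult)
  then have trunc: "l2_bounded K (\<lambda>l k. N l k - truncate J N l k)"
    "l2_opnorm K (\<lambda>l k. N l k - truncate J N l k) \<le> \<tau>"
    using decay[of J] J(1) by auto
  \<comment> \<open>An entry in a marked column survives truncation only within distance
    \<open>J\<close>, and such rows are exactly what the enrichment adds.\<close>
  have supp: "truncate J N l k = 0" if "l \<in> K - ?E" "k \<in> M" for l k
    using that by (auto simp: truncate_def enrichment_def)
  obtain y where y: "energy_norm a (u - w - combination \<psi> ?E y)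
      \<le> \<beta>\<^sub>u / sqrt \<alpha>\<^sub>l * l2_norm (K - M) b + sqrt \<alpha>\<^sub>u / \<beta>\<^sub>l * (\<tau> * l2_norm M b)"
    using truncated_correction[OF w(2) Mfin E l2_inverse_gram[OF inverse] trunc supp]
    unfolding b_def by blast
  \<comment> \<open>The competitor is the old iterate plus the correction, admissible because the
    new index set contains both the old one and the enrichment.\<close>
  have "w + combination \<psi> ?E y \<in> galerkin_space \<phi> \<Lambda>'"
    using galerkin_space_mono[OF fin, of \<Lambda> \<phi>] galerkin_space_mono[OF fin, of ?E \<phi>]
      \<Lambda>(3) combination_galerkin[of ?E y]
    by (intro smult_subspaceD(2)[OF galerkin_space_subspace]) (auto simp: \<Lambda>')
  then have "energy_norm a (u - u') \<le> energy_norm a (u - (w + combination \<psi> ?E y))"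
    using u' u galerkin_space_mem[OF sub]
    by (intro a.best_approximation[of "galerkin_space \<phi> \<Lambda>'"] galerkin_space_subspace)
       (auto simp: galerkin_solution_def)
  also have "\<dots> = energy_norm a (u - w - combination \<psi> ?E y)"
    by (simp add: diff_diff_eq)
  also note y
  also have "\<beta>\<^sub>u / sqrt \<alpha>\<^sub>l * l2_norm (K - M) b + sqrt \<alpha>\<^sub>u / \<beta>\<^sub>l * (\<tau> * l2_norm M b)
      \<le> \<beta>\<^sub>u / sqrt \<alpha>\<^sub>l * (s * \<rho>') + \<beta>\<^sub>u / sqrt \<alpha>\<^sub>l * (s * \<rho>')"
  proof (rule add_mono)
    show "\<beta>\<^sub>u / sqrt \<alpha>\<^sub>l * l2_norm (K - M) b \<le> \<beta>\<^sub>u / sqrt \<alpha>\<^sub>l * (s * \<rho>')"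
      using constants by (intro mult_left_mono rest) auto
    \<comment> \<open>The weight normalisation enters here: it trades
      \<open>1 / \<beta>\<^sub>l\<close> for \<open>\<beta>\<^sub>u\<close>, giving the truncation
      part the same constant as the unmarked part.\<close>
    have \<beta>: "1 / \<beta>\<^sub>l \<le> \<beta>\<^sub>u"
      using normalised constants by (simp add: divide_simps mult.commute)
    have "sqrt \<alpha>\<^sub>u / \<beta>\<^sub>l * (\<tau> * l2_norm M b) \<le> sqrt \<alpha>\<^sub>u / \<beta>\<^sub>l * (\<tau> * \<rho>')"
      using constants s by (intro mult_left_mono marked) (auto simp: \<tau>_def)
    also have "\<dots> = 1 / \<beta>\<^sub>l * (s * \<rho>' / sqrt \<alpha>\<^sub>l)"
      using constants by (simp add: \<tau>_def)
    also have "\<dots> \<le> \<beta>\<^sub>u * (s * \<rho>' / sqrt \<alpha>\<^sub>l)"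
      using constants s \<rho>0 by (intro mult_right_mono \<beta>) auto
    finally show "sqrt \<alpha>\<^sub>u / \<beta>\<^sub>l * (\<tau> * l2_norm M b) \<le> \<beta>\<^sub>u / sqrt \<alpha>\<^sub>l * (s * \<rho>')"
      by (simp add: mult_ac)
  qed
  also have "\<dots> = 2 * (\<beta>\<^sub>u / sqrt \<alpha>\<^sub>l) * C\<^sub>0 * \<rho>'\<^sup>2 / dual_norm K \<phi> d f"
    by (simp add: s_def power2_eq_square)
  finally show "energy_norm a (u - u') \<le>
      2 * (\<beta>\<^sub>u / sqrt \<alpha>\<^sub>l) * C\<^sub>0 * (dual_norm K \<phi> d r)\<^sup>2 / dual_norm K \<phi> d f"
    by (simp add: \<rho>'_def)
qed

end

section \<open>Quadratic convergence\<close>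

theorem theorem3p3:
  fixes lo hi :: "real^'n::finite"
    and \<Omega> :: "(real^'n) set"
    and a :: "'n h1 \<Rightarrow> 'n h1 \<Rightarrow> complex"
    and V :: "'n h1 set"
    and \<nu> \<sigma> :: "real^'n \<Rightarrow> real"
    and \<nu>\<^sub>l \<nu>\<^sub>u \<sigma>\<^sub>l \<sigma>\<^sub>u \<alpha>\<^sub>l \<alpha>\<^sub>u \<beta>\<^sub>l \<beta>\<^sub>u c\<^sub>L \<eta>\<^sub>L C\<^sub>A \<eta>\<^sub>A C\<^sub>0 C\<^sub>1 \<epsilon> :: real
    and f :: "'n functional"
    and K :: "(int^'n) set"
    and \<phi> :: "int^'n \<Rightarrow> 'n h1"
    and d :: "int^'n \<Rightarrow> real"
    and Ainv :: "int^'n \<Rightarrow> int^'n \<Rightarrow> complex"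
    and u :: "'n h1"
    and \<Lambda> :: "nat \<Rightarrow> (int^'n) set"
    and un :: "nat \<Rightarrow> 'n h1"
    and r :: "nat \<Rightarrow> 'n functional"
  assumes abbreviations:
      "\<Omega> = box lo hi"
      "a = energy_form \<Omega> \<nu> \<sigma>"
      "\<alpha>\<^sub>l = min \<nu>\<^sub>l \<sigma>\<^sub>l"
      "\<alpha>\<^sub>u = max \<nu>\<^sub>u \<sigma>\<^sub>u"
      "C\<^sub>1 = sqrt \<alpha>\<^sub>u / (2 * \<beta>\<^sub>l * dual_norm K \<phi> d f)"
    and domain: "\<forall>i. lo $ i < hi $ i"
    and space: "V = H1_0 \<Omega> \<or> V = H1_p lo hi"
    and measurable_coefficients:
      "\<nu> \<in> borel_measurable (lebesgue_on \<Omega>)" "\<sigma> \<in> borel_measurable (lebesgue_on \<Omega>)"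
    and bounds_\<nu>: "0 < \<nu>\<^sub>l" "\<forall>x\<in>\<Omega>. \<nu>\<^sub>l \<le> \<nu> x \<and> \<nu> x \<le> \<nu>\<^sub>u"
    and bounds_\<sigma>: "0 < \<sigma>\<^sub>l" "\<forall>x\<in>\<Omega>. \<sigma>\<^sub>l \<le> \<sigma> x \<and> \<sigma> x \<le> \<sigma>\<^sub>u"
    and rhs: "f \<in> dual_space \<Omega> V" "\<exists>v\<in>V. f v \<noteq> 0"
    and solution: "u \<in> V" "\<forall>v\<in>V. a u v = f v"
    and basis: "infinite K" "riesz_basis \<Omega> V K \<phi> d \<beta>\<^sub>l \<beta>\<^sub>u"
    and normalised_weights: "1 \<le> \<beta>\<^sub>l * \<beta>\<^sub>u"
    and decay: "0 < c\<^sub>L" "0 < \<eta>\<^sub>L"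
      "\<forall>l\<in>K. \<forall>k\<in>K. cmod (stiffness a \<phi> d l k) \<le> c\<^sub>L * exp (- \<eta>\<^sub>L * znorm (l - k))"
    and inverse: "l2_inverse K (stiffness a \<phi> d) Ainv"
    and inverse_decay: "0 < C\<^sub>A" "0 < \<eta>\<^sub>A"
      "\<forall>J\<ge>0. l2_bounded K (\<lambda>l k. Ainv l k - truncate J Ainv l k) \<and>
         l2_opnorm K (\<lambda>l k. Ainv l k - truncate J Ainv l k) \<le> C\<^sub>A * exp (- \<eta>\<^sub>A * J)"
    and marking_constant: "0 < C\<^sub>0" "C\<^sub>0 \<le> 1 / 4 * sqrt (\<alpha>\<^sub>l / \<alpha>\<^sub>u) * (\<beta>\<^sub>l / \<beta>\<^sub>u)"
    and tolerance: "0 < \<epsilon>"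
    and run: "dyn_gal_run \<Omega> a f K \<phi> d \<alpha>\<^sub>l \<alpha>\<^sub>u C\<^sub>A \<eta>\<^sub>A C\<^sub>0 \<epsilon> \<Lambda> un r"
  shows "(\<forall>n. executed K \<phi> d \<epsilon> r n \<longrightarrow>
            dual_norm K \<phi> d (r (Suc n)) / (2 * dual_norm K \<phi> d (r 0))
              \<le> (dual_norm K \<phi> d (r n) / (2 * dual_norm K \<phi> d (r 0)))\<^sup>2) \<and>
         (\<exists>n. dual_norm K \<phi> d (r (Suc n)) \<le> \<epsilon> * dual_norm K \<phi> d (r 0)) \<and>
         (\<forall>n. executed K \<phi> d \<epsilon> r n \<longrightarrow>
            energy_norm a (u - un (Suc n)) \<le> C\<^sub>1 * (energy_norm a (u - un n))\<^sup>2)"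
proof -
  \<comment> \<open>A point of the domain makes the coefficient bounds non-vacuous;
    \<open>0 < \<nu>\<^sub>u\<close> and \<open>\<alpha>\<^sub>l \<le> \<alpha>\<^sub>u\<close> are
    read off there.\<close>
  have "\<Omega> \<noteq> {}"
    using domain by (auto simp: abbreviations(1) box_ne_empty Basis_vec_def inner_axis)
  then obtain x\<^sub>0 where "x\<^sub>0 \<in> \<Omega>" by blast
  then have "0 < \<nu>\<^sub>u"
    using bounds_\<nu> by (meson less_le_trans)
  have coeff: "coefficients \<Omega> \<nu> \<sigma> \<nu>\<^sub>l \<nu>\<^sub>u \<sigma>\<^sub>l \<sigma>\<^sub>u"
    using measurable_coefficients bounds_\<nu> bounds_\<sigma> by (simp add: coefficients_def)
  have "smult_subspace V"
    using space
    by (auto simp: H1_0_def H1_p_def abbreviations(1)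
        intro: H1_closure_subspace smooth_subspace_test smooth_subspace_periodic)
  moreover have "V \<subseteq> L2_pairs \<Omega>"
    using space H1_subset_L2_pairs[of \<Omega>] by (auto simp: H1_0_def H1_p_def H1_closure_def abbreviations(1))
  ultimately interpret P: elliptic_problem \<Omega> \<nu> \<sigma> \<nu>\<^sub>l \<nu>\<^sub>u \<sigma>\<^sub>l \<sigma>\<^sub>u V K \<phi> d \<beta>\<^sub>l \<beta>\<^sub>u
    using coeff \<open>0 < \<nu>\<^sub>u\<close> basis(2) by (simp add: elliptic_problem_def elliptic_problem_axioms_def)
  have eqs: "P.a = a" "P.\<alpha>\<^sub>l = \<alpha>\<^sub>l" "P.\<alpha>\<^sub>u = \<alpha>\<^sub>u"
    by (simp_all only: P.a_def P.\<alpha>\<^sub>l_def P.\<alpha>\<^sub>u_def abbreviations(2-4))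
  note pos = P.constants[unfolded eqs]
  let ?\<rho> = "\<lambda>n. dual_norm K \<phi> d (r n)"
  let ?e = "\<lambda>n. energy_norm a (u - un n)"
  have init: "\<Lambda> 0 = {}" "un 0 = 0" "r 0 = f"
    and steps: "\<And>n. executed K \<phi> d \<epsilon> r n \<Longrightarrow> dyn_gal_step \<Omega> a f K \<phi> d \<alpha>\<^sub>l \<alpha>\<^sub>u C\<^sub>A \<eta>\<^sub>A C\<^sub>0
      (\<Lambda> n) (r n) (\<Lambda> (Suc n)) (un (Suc n)) (r (Suc n))"
    using run by (auto simp: dyn_gal_run_def)
  have residual_le: "dual_norm K \<phi> d g \<le> sqrt \<alpha>\<^sub>u / \<beta>\<^sub>l * energy_norm a e"
    and energy_le: "energy_norm a e \<le> \<beta>\<^sub>u / sqrt \<alpha>\<^sub>l * dual_norm K \<phi> d g"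
    if "e \<in> V" "\<And>v. v \<in> V \<Longrightarrow> g v = a e v" for e g
    using P.residual_l2_norm(2)[OF that(1)] P.energy_norm_le_residual[OF that(1)]
      P.dual_norm_form[OF that(1), of g] that(2) by (simp_all add: eqs)
  have dual_nonneg: "0 \<le> dual_norm K \<phi> d g" for g
    by (simp add: P.dual_norm_eq_l2_norm l2_norm_nonneg)
  define \<rho>\<^sub>0 where "\<rho>\<^sub>0 = dual_norm K \<phi> d f"
  \<comment> \<open>A vanishing dual norm gives \<open>u\<close> zero energy. That need not make
    \<open>u\<close> zero, but Cauchy-Schwarz still annihilates \<open>f v = a u v\<close> for every
    \<open>v\<close>.\<close>
  have "0 < \<rho>\<^sub>0"
  proof (rule ccontr)
    assume "\<not> 0 < \<rho>\<^sub>0"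
    then have "\<rho>\<^sub>0 = 0"
      using dual_nonneg[of f] by (simp add: \<rho>\<^sub>0_def)
    then have "energy_norm a u = 0"
      using energy_le[of u f] solution P.a.energy_norm_nonneg[OF solution(1)]
      by (simp add: \<rho>\<^sub>0_def eqs)
    then have "f v = 0" if "v \<in> V" for v
      using P.a.Cauchy_Schwarz[OF solution(1) that] solution(2) that by (simp add: eqs)
    then show False
      using rhs(2) by blast
  qed
  have "\<alpha>\<^sub>l \<le> \<alpha>\<^sub>u"
    using bounds_\<nu>(2) \<open>x\<^sub>0 \<in> \<Omega>\<close> unfolding abbreviations(3,4) by fastforce
  have "\<beta>\<^sub>l \<le> \<beta>\<^sub>u"
    using basis(2) by (simp add: riesz_basis_def)
  \<comment> \<open>Together with residuals not exceeding the initial one, this keeps the radicand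
    in the marking parameter nonnegative.\<close>
  have "C\<^sub>0 \<le> 1"
  proof -
    have "sqrt (\<alpha>\<^sub>l / \<alpha>\<^sub>u) * (\<beta>\<^sub>l / \<beta>\<^sub>u) \<le> 1 * 1"
      using \<open>\<alpha>\<^sub>l \<le> \<alpha>\<^sub>u\<close> \<open>\<beta>\<^sub>l \<le> \<beta>\<^sub>u\<close> pos by (intro mult_mono) auto
    moreover have "C\<^sub>0 \<le> 1" if "q \<le> 1 * 1" "C\<^sub>0 \<le> 1 / 4 * q" for q
      using that by simp
    ultimately show ?thesis
      using marking_constant(2) unfolding mult.assoc by blast
  qed
  define c where "c = 2 * (\<beta>\<^sub>u / sqrt \<alpha>\<^sub>l) * C\<^sub>0"
  have "0 \<le> c"
    using pos marking_constant(1) by (simp add: c_def)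
  \<comment> \<open>Here the hypothesis on \<open>C\<^sub>0\<close> is spent: its 1/4 against the 2
    in \<open>c\<close> leaves 1/2, and the remaining quotients cancel.\<close>
  have c_le: "c * (sqrt \<alpha>\<^sub>u / \<beta>\<^sub>l) \<le> 1 / 2"
  proof -
    have "c * (sqrt \<alpha>\<^sub>u / \<beta>\<^sub>l) = C\<^sub>0 * (2 * (\<beta>\<^sub>u / sqrt \<alpha>\<^sub>l) * (sqrt \<alpha>\<^sub>u / \<beta>\<^sub>l))"
      by (simp add: c_def)
    also have "\<dots> \<le> 1 / 4 * sqrt (\<alpha>\<^sub>l / \<alpha>\<^sub>u) * (\<beta>\<^sub>l / \<beta>\<^sub>u) * (2 * (\<beta>\<^sub>u / sqrt \<alpha>\<^sub>l) * (sqrt \<alpha>\<^sub>u / \<beta>\<^sub>l))"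
      using pos by (intro mult_right_mono marking_constant(2)) auto
    also have "\<dots> = 1 / 2"
      using pos by (simp add: real_sqrt_divide field_simps)
    finally show ?thesis .
  qed
  \<comment> \<open>Besides the structural facts, the invariant carries monotonicity relative to the
    initial residual, which makes the next marking parameter meaningful.\<close>
  define Inv where "Inv n \<longleftrightarrow> finite (\<Lambda> n) \<and> \<Lambda> n \<subseteq> K \<and> un n \<in> galerkin_space \<phi> (\<Lambda> n) \<and>
    (\<forall>v\<in>V. r n v = a (u - un n) v) \<and> ?\<rho> n \<le> \<rho>\<^sub>0" for n
  have err_mem: "u - un n \<in> V" if "Inv n" for n
    using that P.galerkin_space_mem[of "\<Lambda> n" "un n"] solution(1) P.a.closed(5)
    by (simp add: Inv_def)
  have one_step: "Inv (Suc n)" "?\<rho> (Suc n) \<le> (?\<rho> n)\<^sup>2 / (2 * \<rho>\<^sub>0)" "?e (Suc n) \<le> c * (?\<rho> n)\<^sup>2 / \<rho>\<^sub>0"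
    if ex: "executed K \<phi> d \<epsilon> r n" and inv: "Inv n" for n
  proof -
    have "C\<^sub>0 * ?\<rho> n \<le> 1 * \<rho>\<^sub>0"
      using inv \<open>C\<^sub>0 \<le> 1\<close> marking_constant(1) dual_nonneg by (intro mult_mono) (auto simp: Inv_def)
    then have est: "finite (\<Lambda> (Suc n))" "\<Lambda> (Suc n) \<subseteq> K" "un (Suc n) \<in> galerkin_space \<phi> (\<Lambda> (Suc n))"
      "\<And>v. v \<in> V \<Longrightarrow> r (Suc n) v = a (u - un (Suc n)) v" "?e (Suc n) \<le> c * (?\<rho> n)\<^sup>2 / \<rho>\<^sub>0"
      using P.dyn_gal_step_energy_estimate[unfolded eqs, OF steps[OF ex] solution(1) _ _ _ _ _
          normalised_weights inverse, of "un n"] solution(2) inv inverse_decay(3)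
        \<open>0 < \<rho>\<^sub>0\<close> marking_constant(1) by (simp_all add: Inv_def c_def \<rho>\<^sub>0_def)
    then show "?e (Suc n) \<le> c * (?\<rho> n)\<^sup>2 / \<rho>\<^sub>0" by blast
    have "u - un (Suc n) \<in> V"
      using P.galerkin_space_mem[OF est(2,3)] solution(1) P.a.closed(5) by simp
    then have "?\<rho> (Suc n) \<le> sqrt \<alpha>\<^sub>u / \<beta>\<^sub>l * ?e (Suc n)"
      using est(4) by (rule residual_le)
    also have "\<dots> \<le> sqrt \<alpha>\<^sub>u / \<beta>\<^sub>l * (c * (?\<rho> n)\<^sup>2 / \<rho>\<^sub>0)"
      using pos by (intro mult_left_mono est(5)) auto
    also have "\<dots> = c * (sqrt \<alpha>\<^sub>u / \<beta>\<^sub>l) * ((?\<rho> n)\<^sup>2 / \<rho>\<^sub>0)"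
      by simp
    also have "\<dots> \<le> 1 / 2 * ((?\<rho> n)\<^sup>2 / \<rho>\<^sub>0)"
      using \<open>0 < \<rho>\<^sub>0\<close> by (intro mult_right_mono c_le) auto
    finally show quad: "?\<rho> (Suc n) \<le> (?\<rho> n)\<^sup>2 / (2 * \<rho>\<^sub>0)"
      by simp
    \<comment> \<open>Below the initial residual the quadratic bound gains a factor 1/2, so the
      invariant persists.\<close>
    have "(?\<rho> n)\<^sup>2 \<le> \<rho>\<^sub>0\<^sup>2"
      using inv dual_nonneg by (intro power_mono) (auto simp: Inv_def)
    then have "(?\<rho> n)\<^sup>2 / (2 * \<rho>\<^sub>0) \<le> \<rho>\<^sub>0\<^sup>2 / (2 * \<rho>\<^sub>0)"
      using \<open>0 < \<rho>\<^sub>0\<close> by (intro divide_right_mono) auto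
    also have "\<dots> \<le> \<rho>\<^sub>0"
      using \<open>0 < \<rho>\<^sub>0\<close> by (simp add: power2_eq_square)
    finally show "Inv (Suc n)"
      using est quad by (simp add: Inv_def)
  qed
  \<comment> \<open>An executed pass has only executed predecessors, so the induction never leaves
    the range where the sequences are constrained. At 0 the Galerkin space over the empty set
    contains just 0.\<close>
  have inv: "Inv n" if "executed K \<phi> d \<epsilon> r n" for n
    using that
  proof (induction n)
    case 0
    have "0 \<in> galerkin_space \<phi> {}"
      by (simp add: galerkin_space_def)
    then show ?case
      using solution(2) by (simp add: Inv_def init \<rho>\<^sub>0_def)
  next
    case (Suc n)
    then have "executed K \<phi> d \<epsilon> r n"
      by (simp add: executed_def)
    then show ?case
      using one_step(1) Suc.IH by blast
  qed
  have quadratic: "?\<rho> (Suc n) / (2 * ?\<rho> 0) \<le> (?\<rho> n / (2 * ?\<rho> 0))\<^sup>2" if "executed K \<phi> d \<epsilon> r n" for n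
  proof -
    have "?\<rho> (Suc n) / (2 * \<rho>\<^sub>0) \<le> (?\<rho> n)\<^sup>2 / (2 * \<rho>\<^sub>0) / (2 * \<rho>\<^sub>0)"
      using one_step(2)[OF that inv[OF that]] \<open>0 < \<rho>\<^sub>0\<close> by (intro divide_right_mono) auto
    then show ?thesis
      by (simp add: init(3) \<rho>\<^sub>0_def[symmetric] power2_eq_square)
  qed
  moreover have "\<exists>n. ?\<rho> (Suc n) \<le> \<epsilon> * ?\<rho> 0"
  proof (rule ccontr)
    \<comment> \<open>Without a successful stopping test every pass is executed. Halving of the
      residuals, weaker than the quadratic estimate, already contradicts this.\<close>
    assume never: "\<not> ?thesis"
    then have ex: "executed K \<phi> d \<epsilon> r n" for n
      by (auto simp: executed_def)
    have "?\<rho> (Suc n) \<le> 1 / 2 * ?\<rho> n" for n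
    proof -
      have "?\<rho> (Suc n) \<le> ?\<rho> n * ?\<rho> n / (2 * \<rho>\<^sub>0)"
        using one_step(2)[OF ex inv[OF ex]] by (simp add: power2_eq_square)
      also have "\<dots> \<le> ?\<rho> n * \<rho>\<^sub>0 / (2 * \<rho>\<^sub>0)"
        using inv[OF ex, of n] dual_nonneg \<open>0 < \<rho>\<^sub>0\<close>
        by (intro divide_right_mono mult_left_mono) (auto simp: Inv_def)
      finally show ?thesis
        using \<open>0 < \<rho>\<^sub>0\<close> by simp
    qed
    then have geometric: "?\<rho> n \<le> (1 / 2) ^ n * \<rho>\<^sub>0" for n
    proof (induction n)
      case (Suc n)
      have "?\<rho> (Suc n) \<le> 1 / 2 * ?\<rho> n" by (rule Suc.prems)
      also have "\<dots> \<le> 1 / 2 * ((1 / 2) ^ n * \<rho>\<^sub>0)"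
        using Suc by (intro mult_left_mono) auto
      finally show ?case by simp
    qed (simp add: init \<rho>\<^sub>0_def)
    obtain n where "(1 / 2 :: real) ^ n < \<epsilon>"
      using real_arch_pow_inv[OF tolerance, of "1 / 2"] by auto
    \<comment> \<open>The test examines only successor indices, hence the shift by one.\<close>
    then have "(1 / 2 :: real) ^ Suc n \<le> \<epsilon>"
      using zero_le_power[of "1 / 2 :: real" n] by (simp add: field_simps)
    then have "(1 / 2) ^ Suc n * \<rho>\<^sub>0 \<le> \<epsilon> * \<rho>\<^sub>0"
      using \<open>0 < \<rho>\<^sub>0\<close> by (intro mult_right_mono) auto
    then have "?\<rho> (Suc n) \<le> \<epsilon> * ?\<rho> 0"
      using geometric[of "Suc n"] by (simp only: init(3) \<rho>\<^sub>0_def)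
    then show False
      using never by blast
  qed
  moreover have "?e (Suc n) \<le> C\<^sub>1 * (?e n)\<^sup>2" if "executed K \<phi> d \<epsilon> r n" for n
  proof -
    let ?q = "sqrt \<alpha>\<^sub>u / \<beta>\<^sub>l"
    have "?\<rho> n \<le> ?q * ?e n"
      using inv[OF that] err_mem[OF inv[OF that]] by (intro residual_le) (auto simp: Inv_def)
    then have "(?\<rho> n)\<^sup>2 \<le> (?q * ?e n)\<^sup>2"
      using dual_nonneg by (rule power_mono)
    have "?e (Suc n) \<le> c * (?\<rho> n)\<^sup>2 / \<rho>\<^sub>0"
      by (rule one_step(3)[OF that inv[OF that]])
    also have "\<dots> \<le> c * (?q * ?e n)\<^sup>2 / \<rho>\<^sub>0"
      using \<open>0 \<le> c\<close> \<open>0 < \<rho>\<^sub>0\<close> \<open>(?\<rho> n)\<^sup>2 \<le> (?q * ?e n)\<^sup>2\<close>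
      by (intro divide_right_mono mult_left_mono) auto
    \<comment> \<open>One factor \<open>?q\<close> is absorbed by \<open>c_le\<close>; the other,
      with the resulting 1/2 and the initial residual, is \<open>C\<^sub>1\<close>.\<close>
    also have "\<dots> = c * ?q * (?q / \<rho>\<^sub>0 * (?e n)\<^sup>2)"
      by (simp add: power2_eq_square mult_ac)
    also have "\<dots> \<le> 1 / 2 * (?q / \<rho>\<^sub>0 * (?e n)\<^sup>2)"
      using pos \<open>0 < \<rho>\<^sub>0\<close> by (intro mult_right_mono c_le) auto
    also have "\<dots> = C\<^sub>1 * (?e n)\<^sup>2"
      by (simp add: abbreviations(5) \<rho>\<^sub>0_def)
    finally show ?thesis .
  qed
  ultimately show ?thesis
    by blast
qed

end
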